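(* Let $H_L(s)$ be the Shannon entropy, and $R_L(s):=\log L-H_L(s)$ the relative entropy with respect to the uniform distribution, of the rate-1 random walk (simple or directed) on $\mathbb{Z}_L$ at time $s$. Then, uniformly in all $L\in\mathbb{N}$, $$\max_{s\in[r,\,cL^2]}\bigl|H_L(s)-\tfrac12\log(2\pi e s)\bigr| = o_{r\to\infty}(1)+o_{c\to0}(1).$$ Equivalently, uniformly in all $L\in\mathbb{N}$, $$\max_{s\in[r,\,cL^2]}\bigl|R_L(s)-\tfrac12\log(L^2/s)+\tfrac12\log(2\pi e)\bigr| = o_{r\to\infty}(1)+o_{c\to0}(1).$$
   Context: The rate-1 simple random walk on $\mathbb{Z}_L=\mathbb{Z}/L\mathbb{Z}$ started at $0$ jumps at rate 1, each jump being $+1$ or $-1$ (mod $L$) with probability $1/2$ each; the rate-1 directed random walk is the same but each jump is $+1$ (mod $L$). If $\nu_{L,s}$ is the law at time $s$, then $H_L(s):=-\sum_{x\in\mathbb{Z}_L}\nu_{L,s}(x)\log\nu_{L,s}(x)$ (natural logarithm). Here $o_{r\to\infty}(1)$ denotes a quantity depending only on $r$ tending to $0$ as $r\to\infty$, and $o_{c\to0}(1)$ a quantity depending only on $c$ tending to $0$ as $c\to0$; the statement means that the maximum is bounded by the sum of two such quantities, not depending on $L$, for all $r,c>0$ with $r\le cL^2$. *)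

theory Defs
  imports "HOL-Probability.Probability"
begin

text \<open>
  The cyclic group of order \<open>L\<close> is represented by the residues \<open>{0..<int L}\<close>, so that
  \<open>j mod int L\<close> is the class of \<open>j\<close>. Jumps are integer-valued.
\<close>

definition simple_step :: "int pmf" where
  "simple_step = pmf_of_set {1, -1}"

definition directed_step :: "int pmf" where
  "directed_step = return_pmf 1"

text \<open>
  The jump times of the rate-1 walk started at \<open>0\<close> form a rate-1 Poisson process independent of
  the i.i.d. jumps. Hence at time \<open>s > 0\<close> the walk has made a Poisson(\<open>s\<close>) number \<open>n\<close> of
  jumps and sits at the class of the sum of \<open>n\<close> independent jumps.
  (\<open>poisson_pmf s\<close> is only specified for \<open>s > 0\<close>.)
\<close>

definition walk_law :: "int pmf \<Rightarrow> nat \<Rightarrow> real \<Rightarrow> int pmf" where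
  "walk_law \<xi> L s =
     bind_pmf (poisson_pmf s)
       (\<lambda>n. map_pmf (\<lambda>js. sum_list js mod int L) (replicate_pmf n \<xi>))"

text \<open>The convention \<open>0 log 0 = 0\<close> holds automatically.\<close>

definition walk_entropy :: "int pmf \<Rightarrow> nat \<Rightarrow> real \<Rightarrow> real" where
  "walk_entropy \<xi> L s =
     - (\<Sum>x\<in>{0..<int L}. pmf (walk_law \<xi> L s) x * ln (pmf (walk_law \<xi> L s) x))"

definition walk_rel_entropy :: "int pmf \<Rightarrow> nat \<Rightarrow> real \<Rightarrow> real" where
  "walk_rel_entropy \<xi> L s = ln (real L) - walk_entropy \<xi> L s"

end

theory Submission
  imports Defs "HOL-Real_Asymp.Real_Asymp"
begin

text \<open>
  Both walks are reductions modulo \<open>L\<close> of a walk on \<open>\<int>\<close> whose law \<open>p\<close> at time \<open>s\<close> has mean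
  \<open>a\<close> (\<open>0\<close> or \<open>s\<close>) and variance exactly \<open>s\<close>. A Gaussian of variance \<open>s\<close> has entropy
  \<open>1/2 ln (2 \<pi> e s)\<close>. The entropy of the walk is close to this value when \<open>s\<close> is large, so that
  lattice effects disappear, and when \<open>c = s / L\<^sup>2\<close> is small, so that the walk has not yet wrapped
  around the cycle. The theorem follows from one bound, valid for all \<open>s > 0\<close> and \<open>L \<ge> 1\<close>
  (\<open>walk_entropy_error\<close>): the error is at most a constant times
  \<open>1 / ln (1 + s) + sqrt c + c\<close>. The first term decreases in \<open>s\<close> and the others increase in \<open>c\<close>,
  so their values at \<open>r\<close> and at the largest admissible \<open>c\<close> serve as the two required functions.

  The residues are represented by the window of \<open>L\<close> consecutive integers nearest to \<open>a\<close>. Write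
  \<open>R x\<close> for the probability that the walk is congruent to \<open>x\<close>, and \<open>gexp x = (x - a)\<^sup>2 / (2 s)\<close> for
  the Gaussian exponent.

  Upper bound (\<open>entropy_le\<close>). By the Gibbs inequality the entropy is at most the cross entropy
  relative to the normalised weights \<open>exp (- gexp x)\<close> on the window. Moving a point to its
  representative in the window does not increase \<open>gexp\<close>, hence the mean of \<open>gexp\<close> is at most \<open>1/2\<close>; the
  normalising constant is at most \<open>2 + sqrt (2 \<pi> s)\<close>. The resulting error \<open>1 / sqrt s\<close> does not
  involve \<open>L\<close>.

  Lower bound (\<open>entropy_ge_fine\<close>). Fourier inversion on \<open>\<int>\<close> gives
  \<open>p x \<le> (exp (- gexp x) + O(1 / sqrt s)) / sqrt (2 \<pi> s)\<close> (\<open>pmf_le_gauss\<close>), uniformly in \<open>x\<close>.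
  Therefore \<open>- ln (p x)\<close> is at least \<open>1/2 ln (2 \<pi> s) + gexp x\<close> up to an error that is controlled by the
  fourth moment, and \<open>gexp\<close> has mean \<open>1/2\<close>. The mass that \<open>R\<close> has in excess of \<open>p\<close> on the window
  is the probability of being outside the window, which is \<open>O(c)\<close> by Chebyshev. Its contribution to
  the entropy must not lose a factor \<open>ln s\<close>; this is prevented by the bound
  \<open>R x = O(1 / L + 1 / sqrt s)\<close> (\<open>residue_prob_le\<close>), obtained by Fourier inversion on the cycle. The
  same bound shows, without any restriction on \<open>s\<close> and \<open>c\<close>, that the entropy is at least
  \<open>1/2 ln s - O(1 + sqrt c)\<close> (\<open>entropy_ge_coarse\<close>), which covers small \<open>s\<close> and large \<open>c\<close>.
\<close>

section \<open>Gaussian sums and integrals\<close>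

text \<open>
  The summand decreases, so the sum exceeds the integral over the half line by at most the term at
  \<open>0\<close>.
\<close>

lemma sum_exp_neg_square_le:
  fixes s :: real
  assumes "s > 0"
  shows "(\<Sum>k\<le>n. exp (- (real k)\<^sup>2 / (2 * s))) \<le> 1 + sqrt (2 * pi * s) / 2"
proof -
  define f where "f = (\<lambda>x::real. exp (- x\<^sup>2 / (2 * s)))"
  interpret antimono_fun_sum_integral_diff f
  proof
    show "f y \<le> f x" if "0 \<le> x" "x \<le> y" for x y
      using that assms by (auto simp: f_def divide_right_mono power_mono)
    show "0 \<le> f x" for x by (simp add: f_def)
    show "continuous_on {0..} f"
      unfolding f_def using assms by (intro continuous_intros) auto
  qed
  define \<sigma> where "\<sigma> = sqrt s"
  have \<sigma>: "\<sigma> > 0" "\<sigma>\<^sup>2 = s" using assms by (auto simp: \<sigma>_def)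
  have f_nd: "f x = sqrt (2 * pi * s) * normal_density 0 \<sigma> x" for x
    using \<sigma> assms by (simp add: f_def normal_density_def)
  have int: "integrable lborel f"
    unfolding f_nd using \<sigma> by simp
  have tot: "(LINT x|lborel. f x) = sqrt (2 * pi * s)"
    unfolding f_nd using \<sigma> by simp
  have "integral {0..real n} f = (LINT x:{0..real n}|lborel. f x)"
    by (rule set_borel_integral_eq_integral(2)[symmetric], unfold set_integrable_def)
       (intro integrable_mult_indicator int, simp)
  also have "\<dots> \<le> (LINT x|lborel. indicator {0..} x *\<^sub>R f x)"
    unfolding set_lebesgue_integral_def
    by (intro integral_mono integrable_mult_indicator int)
       (auto simp: f_def indicator_def)
  also have "\<dots> = sqrt (2 * pi * s) / 2"
  proof -
    have "(LINT x|lborel. indicator {0..} x *\<^sub>R f x) = (LINT x|lborel. indicator {0..} (-x) *\<^sub>R f (-x))"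
      using lborel_integral_real_affine[of "-1" "\<lambda>x. indicator {0..} x *\<^sub>R f x" 0] by simp
    also have "\<dots> = (LINT x|lborel. indicator {..0} x *\<^sub>R f x)"
      by (rule Bochner_Integration.integral_cong) (auto simp: f_def indicator_def)
    finally have eq: "(LINT x|lborel. indicator {0..} x *\<^sub>R f x) = (LINT x|lborel. indicator {..0} x *\<^sub>R f x)" .
    have "(LINT x|lborel. indicator {0..} x *\<^sub>R f x) + (LINT x|lborel. indicator {..0} x *\<^sub>R f x)
        = (LINT x|lborel. indicator {0..} x *\<^sub>R f x + indicator {..0} x *\<^sub>R f x)"
      by (rule Bochner_Integration.integral_add[symmetric]) (intro integrable_mult_indicator int, simp)+
    also have "\<dots> = (LINT x|lborel. f x)"
      by (rule integral_cong_AE) 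
         (use int AE_lborel_singleton[of "0::real"] in \<open>auto simp: indicator_def f_def elim!: eventually_mono\<close>)
    finally show ?thesis using eq tot by simp
  qed
  finally have I: "integral {0..real n} f \<le> sqrt (2 * pi * s) / 2" .
  have "sum_integral_diff_series n \<le> sum_integral_diff_series 0"
    by (rule sum_integral_diff_series_antimono) simp
  then show ?thesis
    using I unfolding sum_integral_diff_series_def by (simp add: f_def)
qed

text \<open>
  The centre \<open>a\<close> is arbitrary. The points of \<open>A\<close> on either side of \<open>a\<close> have distinct integer parts
  of their distance to \<open>a\<close>, so each side is dominated by the sum over the natural numbers.
\<close>

lemma gauss_lattice_sum_le:
  fixes s a :: real and A :: "int set"
  assumes "s > 0" "finite A"
  shows "(\<Sum>x\<in>A. exp (- (real_of_int x - a)\<^sup>2 / (2 * s))) \<le> 2 + sqrt (2 * pi * s)"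
proof -
  let ?g = "\<lambda>k::nat. exp (- (real k)\<^sup>2 / (2 * s))"
  \<comment> \<open>Applied to the two sides of \<open>a\<close>, with \<open>h x\<close> a lower integer approximation of the distance to \<open>a\<close>.\<close>
  have half: "(\<Sum>x\<in>B. exp (- (real_of_int x - a)\<^sup>2 / (2 * s))) \<le> 1 + sqrt (2 * pi * s) / 2"
    if B: "finite B" and h: "inj_on h B" "\<And>x. x \<in> B \<Longrightarrow> real (h x) \<le> \<bar>real_of_int x - a\<bar>"
    for B and h :: "int \<Rightarrow> nat"
  proof -
    have "(\<Sum>x\<in>B. exp (- (real_of_int x - a)\<^sup>2 / (2 * s))) \<le> (\<Sum>x\<in>B. ?g (h x))"
    proof (rule sum_mono)
      fix x assume "x \<in> B"
      have "(real (h x))\<^sup>2 \<le> \<bar>real_of_int x - a\<bar>\<^sup>2"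
        using h(2)[OF \<open>x \<in> B\<close>] by (intro power_mono) auto
      then show "exp (- (real_of_int x - a)\<^sup>2 / (2 * s)) \<le> ?g (h x)"
        using assms(1) by (simp add: divide_right_mono)
    qed
    also have "\<dots> = sum ?g (h ` B)"
      using h(1) by (simp add: sum.reindex)
    also have "\<dots> \<le> sum ?g {..Max (insert 0 (h ` B))}"
      using B by (intro sum_mono2) auto
    also have "\<dots> \<le> 1 + sqrt (2 * pi * s) / 2"
      by (rule sum_exp_neg_square_le[OF assms(1)])
    finally show ?thesis .
  qed
  have "(\<Sum>x\<in>A. exp (- (real_of_int x - a)\<^sup>2 / (2 * s)))
      = (\<Sum>x\<in>{x\<in>A. a \<le> x}. exp (- (real_of_int x - a)\<^sup>2 / (2 * s)))
      + (\<Sum>x\<in>{x\<in>A. \<not> a \<le> x}. exp (- (real_of_int x - a)\<^sup>2 / (2 * s)))"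
    using assms(2) by (subst sum.union_disjoint[symmetric]) (auto intro!: sum.cong)
  also have "\<dots> \<le> (1 + sqrt (2 * pi * s) / 2) + (1 + sqrt (2 * pi * s) / 2)"
  proof (rule add_mono)
    have inj1: "inj_on (\<lambda>x. nat (x - \<lceil>a\<rceil>)) {x\<in>A. a \<le> x}"
    proof (rule inj_onI)
      fix x y assume "x \<in> {x\<in>A. a \<le> x}" "y \<in> {x\<in>A. a \<le> x}" and e: "nat (x - \<lceil>a\<rceil>) = nat (y - \<lceil>a\<rceil>)"
      then have "\<lceil>a\<rceil> \<le> x" "\<lceil>a\<rceil> \<le> y" by (auto simp: ceiling_le_iff)
      with e show "x = y" by linarith
    qed
    have inj2: "inj_on (\<lambda>x. nat (\<lfloor>a\<rfloor> - x)) {x\<in>A. \<not> a \<le> x}"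
    proof (rule inj_onI)
      fix x y assume "x \<in> {x\<in>A. \<not> a \<le> x}" "y \<in> {x\<in>A. \<not> a \<le> x}" and e: "nat (\<lfloor>a\<rfloor> - x) = nat (\<lfloor>a\<rfloor> - y)"
      then have "x \<le> \<lfloor>a\<rfloor>" "y \<le> \<lfloor>a\<rfloor>" by (auto simp: le_floor_iff)
      with e show "x = y" by linarith
    qed
    show "(\<Sum>x\<in>{x\<in>A. a \<le> x}. exp (- (real_of_int x - a)\<^sup>2 / (2 * s))) \<le> 1 + sqrt (2 * pi * s) / 2"
    proof (rule half[OF _ inj1])
      fix x assume "x \<in> {x\<in>A. a \<le> x}"
      then show "real (nat (x - \<lceil>a\<rceil>)) \<le> \<bar>real_of_int x - a\<bar>" by simp linarith
    qed (use assms in auto)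
    show "(\<Sum>x\<in>{x\<in>A. \<not> a \<le> x}. exp (- (real_of_int x - a)\<^sup>2 / (2 * s))) \<le> 1 + sqrt (2 * pi * s) / 2"
    proof (rule half[OF _ inj2])
      fix x assume "x \<in> {x\<in>A. \<not> a \<le> x}"
      then show "real (nat (\<lfloor>a\<rfloor> - x)) \<le> \<bar>real_of_int x - a\<bar>" by simp linarith
    qed (use assms in auto)
  qed
  finally show ?thesis by simp
qed

lemma abs_moment_gauss:
  fixes \<sigma> :: real
  assumes "\<sigma> > 0"
  shows "has_bochner_integral lborel (\<lambda>t. \<bar>t\<bar> * exp (- t\<^sup>2 / (2 * \<sigma>\<^sup>2))) (2 * \<sigma>\<^sup>2)"
    and "has_bochner_integral lborel (\<lambda>t. \<bar>t\<bar> ^ 3 * exp (- t\<^sup>2 / (2 * \<sigma>\<^sup>2))) (4 * \<sigma> ^ 4)"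
proof -
  let ?c = "sqrt (2 * pi * \<sigma>\<^sup>2)"
  have nd: "?c * normal_density 0 \<sigma> t = exp (- t\<^sup>2 / (2 * \<sigma>\<^sup>2))" for t
    using assms by (simp add: normal_density_def)
  have c: "sqrt (2 / pi) * ?c = 2 * \<sigma>"
  proof -
    have "2 / pi * (2 * pi * \<sigma>\<^sup>2) = (2 * \<sigma>)\<^sup>2" by (simp add: power2_eq_square)
    then show ?thesis using assms unfolding real_sqrt_mult[symmetric] by (simp only: real_sqrt_abs abs_mult abs_of_pos abs_numeral)
  qed
  have 0: "?c * (normal_density 0 \<sigma> t * \<bar>t\<bar> ^ k) = \<bar>t\<bar> ^ k * exp (- t\<^sup>2 / (2 * \<sigma>\<^sup>2))" for t k
    unfolding nd[symmetric] by simp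
  have "has_bochner_integral lborel (\<lambda>t. ?c * (normal_density 0 \<sigma> t * \<bar>t\<bar> ^ 1)) (?c * (\<sigma> * sqrt (2 / pi)))"
    using normal_moment_abs_odd[OF assms, of 0 0] by (intro has_bochner_integral_mult_right) simp
  also have "?c * (\<sigma> * sqrt (2 / pi)) = \<sigma> * (sqrt (2 / pi) * ?c)" by simp
  finally show "has_bochner_integral lborel (\<lambda>t. \<bar>t\<bar> * exp (- t\<^sup>2 / (2 * \<sigma>\<^sup>2))) (2 * \<sigma>\<^sup>2)"
    unfolding 0 c by (simp add: power2_eq_square mult_ac)
  have "has_bochner_integral lborel (\<lambda>t. ?c * (normal_density 0 \<sigma> t * \<bar>t\<bar> ^ 3)) (?c * (2 * \<sigma> ^ 3 * sqrt (2 / pi)))"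
    using normal_moment_abs_odd[OF assms, of 0 1]
    by (intro has_bochner_integral_mult_right) (simp add: eval_nat_numeral)
  also have "?c * (2 * \<sigma> ^ 3 * sqrt (2 / pi)) = 2 * \<sigma> ^ 3 * (sqrt (2 / pi) * ?c)" by simp
  finally show "has_bochner_integral lborel (\<lambda>t. \<bar>t\<bar> ^ 3 * exp (- t\<^sup>2 / (2 * \<sigma>\<^sup>2))) (4 * \<sigma> ^ 4)"
    unfolding 0 c by (simp add: eval_nat_numeral mult_ac)
qed

text \<open>
  The characteristic function of the standard normal distribution, rescaled.
\<close>

lemma cos_integral_gauss:
  fixes s y :: real
  assumes "s > 0"
  shows "has_bochner_integral lborel (\<lambda>t. cos (t * y) * exp (- (s * t\<^sup>2) / 2))
     (sqrt (2 * pi / s) * exp (- y\<^sup>2 / (2 * s)))"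
proof -
  define u where "u = y / sqrt s"
  have int: "integrable lborel (\<lambda>t. std_normal_density t *\<^sub>R cos (u * t))"
  proof (rule Bochner_Integration.integrable_bound[where f = std_normal_density])
    show "AE t in lborel. norm (std_normal_density t *\<^sub>R cos (u * t)) \<le> norm (std_normal_density t)"
    proof (rule AE_I2)
      fix t
      have "\<bar>std_normal_density t\<bar> * \<bar>cos (u * t)\<bar> \<le> \<bar>std_normal_density t\<bar> * 1"
        by (intro mult_left_mono) auto
      then show "norm (std_normal_density t *\<^sub>R cos (u * t)) \<le> norm (std_normal_density t)"
        by (simp only: real_norm_def real_scaleR_def abs_mult mult_1_right)
    qed
  qed auto
  have "integrable std_normal_distribution (\<lambda>x. iexp (u * x))"
  proof -
    interpret real_distribution std_normal_distribution by (rule real_dist_normal_dist)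
    show ?thesis using integrable_iexp[of "\<lambda>x. complex_of_real (u * x)"] by simp
  qed
  then have "Re (char std_normal_distribution u) = (LINT x|std_normal_distribution. Re (iexp (u * x)))"
    unfolding char_def by (rule integral_Re[symmetric])
  also have "\<dots> = (LINT x|lborel. std_normal_density x *\<^sub>R cos (u * x))"
    by (subst integral_density) (auto simp: Re_exp)
  finally have "has_bochner_integral lborel (\<lambda>t. std_normal_density t * cos (u * t)) (exp (- (u\<^sup>2) / 2))"
    using int by (simp add: has_bochner_integral_iff char_std_normal_distribution)
  then have "has_bochner_integral lborel (\<lambda>t. sqrt (2 * pi) * (std_normal_density t * cos (u * t)))
      (sqrt (2 * pi) * exp (- (u\<^sup>2) / 2))"
    by (rule has_bochner_integral_mult_right)
  also have "(\<lambda>t. sqrt (2 * pi) * (std_normal_density t * cos (u * t))) = (\<lambda>t. cos (u * t) * exp (- t\<^sup>2 / 2))"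
    by (rule ext) (simp add: normal_density_def)
  finally have "has_bochner_integral lborel (\<lambda>t. cos (u * (0 + sqrt s * t)) * exp (- (0 + sqrt s * t)\<^sup>2 / 2))
      ((sqrt (2 * pi) * exp (- (u\<^sup>2) / 2)) /\<^sub>R \<bar>sqrt s\<bar>)"
    using assms by (subst (asm) lborel_has_bochner_integral_real_affine_iff[where c = "sqrt s" and t = 0]) auto
  also have "(\<lambda>t. cos (u * (0 + sqrt s * t)) * exp (- (0 + sqrt s * t)\<^sup>2 / 2)) = (\<lambda>t. cos (t * y) * exp (- (s * t\<^sup>2) / 2))"
    using assms by (intro ext) (simp add: u_def power_mult_distrib mult.commute)
  also have "(sqrt (2 * pi) * exp (- (u\<^sup>2) / 2)) /\<^sub>R \<bar>sqrt s\<bar> = sqrt (2 * pi / s) * exp (- y\<^sup>2 / (2 * s))"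
  proof -
    have e: "- (u\<^sup>2) / 2 = - y\<^sup>2 / (2 * s)" using assms by (simp add: u_def power_divide)
    have "\<bar>sqrt s\<bar> = sqrt s" using assms by simp
    then show ?thesis unfolding e real_sqrt_divide real_scaleR_def by (simp only: divide_inverse mult_ac)
  qed
  finally show ?thesis .
qed

section \<open>Fourier inversion on the cycle and on the integers\<close>

lemma sum_cos_residues:
  fixes m :: int
  assumes "L > 0"
  shows "(\<Sum>k<L. cos (2 * pi * real k / real L * real_of_int m)) = (if int L dvd m then real L else 0)"
proof -
  define w where "w = cis (2 * pi * real_of_int m / real L)"
  have "(\<Sum>k<L. cos (2 * pi * real k / real L * real_of_int m)) = Re (\<Sum>k<L. w ^ k)"
    unfolding w_def Complex.DeMoivre Re_sum by (intro sum.cong refl) (simp add: field_simps)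
  also have "\<dots> = (if int L dvd m then real L else 0)"
  proof (cases "int L dvd m")
    case True
    then obtain j where "m = int L * j" by (elim dvdE)
    then have "2 * pi * real_of_int m / real L = 2 * pi * of_int j" using assms by simp
    then have "w = cis (2 * pi * of_int j)" by (simp only: w_def)
    also have "\<dots> = 1" by (rule complex_eqI) (simp_all only: cis.sel cos_int_2pin sin_int_2pin one_complex.sel)
    finally show ?thesis using True by simp
  next
    case False
    have "w \<noteq> 1"
    proof
      assume "w = 1"
      then have "cos (2 * pi * real_of_int m / real L) = 1"
        unfolding w_def by (metis cis.sel(1) one_complex.sel(1))
      then obtain n :: int where "2 * pi * real_of_int m / real L = of_int n * 2 * pi"
        unfolding cos_one_2pi_int by blast
      then have "real_of_int m = real_of_int (n * int L)"
        using assms by (simp add: divide_eq_eq)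
      then have "m = n * int L" by (simp only: of_int_eq_iff)
      with False show False by simp
    qed
    have "w ^ L = cis (2 * pi * real_of_int m)"
      unfolding w_def Complex.DeMoivre using assms by (intro arg_cong[where f = cis]) simp
    also have "\<dots> = 1" by (rule complex_eqI) (simp_all only: cis.sel cos_int_2pin sin_int_2pin one_complex.sel)
    finally have "w ^ L = 1" .
    with \<open>w \<noteq> 1\<close> show ?thesis using False by (simp add: sum_gp_strict)
  qed
  finally show ?thesis .
qed

lemma integral_cos_int:
  fixes m :: int
  shows "(LINT t:{-pi..pi}|lborel. cos (t * real_of_int m)) = (if m = 0 then 2 * pi else 0)"
proof (cases "m = 0")
  case False
  have "(LINT t|lborel. indicator {-pi..pi} t *\<^sub>R cos (t * real_of_int m))
      = sin (pi * real_of_int m) / real_of_int m - sin (- pi * real_of_int m) / real_of_int m"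
    by (rule integral_FTC_Icc)
       (use False in \<open>auto intro!: derivative_eq_intros continuous_intros
          simp: has_real_derivative_iff_has_vector_derivative[symmetric]\<close>)
  then show ?thesis using False by (simp add: set_lebesgue_integral_def sin_integer_2pi)
qed (simp add: set_lebesgue_integral_def)

text \<open>
  Inversion formula in real form: average the orthogonality relation of the preceding lemma over
  the law \<open>p\<close> and exchange the integrals.
\<close>

lemma has_integral_pmf_cos:
  fixes p :: "int pmf" and x :: int
  shows "has_bochner_integral lborel
    (\<lambda>t. indicator {-pi..pi} t * measure_pmf.expectation p (\<lambda>z. cos (t * real_of_int (z - x)))) (2 * pi * pmf p x)"
proof -
  interpret pair_sigma_finite lborel "measure_pmf p"
    by (intro pair_sigma_finite.intro) (auto intro: sigma_finite_lborel measure_pmf.sigma_finite_measure_axioms)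
  let ?f = "\<lambda>t z. indicator {-pi..pi} t *\<^sub>R cos (t * real_of_int (z - x))"
  have meas: "case_prod ?f \<in> borel_measurable (lborel \<Otimes>\<^sub>M measure_pmf p)"
  proof -
    have "(\<lambda>(t, z). ?f t z) \<in> borel_measurable (lborel \<Otimes>\<^sub>M count_space UNIV)"
      by measurable
    then show ?thesis
      by (simp cong: measurable_cong_sets add: sets_pair_measure_cong)
  qed
  have int: "integrable (lborel \<Otimes>\<^sub>M measure_pmf p) (case_prod ?f)"
  proof (rule Bochner_Integration.integrable_bound[OF _ meas])
    show "integrable (lborel \<Otimes>\<^sub>M measure_pmf p) (\<lambda>tz. indicator ({-pi..pi} \<times> UNIV) tz :: real)"
      by (auto simp: measure_pmf.emeasure_pair_measure_Times measure_pmf.emeasure_space_1 intro!: integrable_real_indicator)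
    show "AE tz in lborel \<Otimes>\<^sub>M measure_pmf p. norm (case_prod ?f tz) \<le> norm (indicator ({-pi..pi} \<times> UNIV) tz :: real)"
      by (auto simp: indicator_def)
  qed
  have "(LINT t|lborel. (\<integral>z. ?f t z \<partial>measure_pmf p)) = (\<integral>z. (LINT t|lborel. ?f t z) \<partial>measure_pmf p)"
    by (rule Fubini_integral[symmetric, OF int])
  also have "\<dots> = (\<integral>z. 2 * pi * indicator {x} z \<partial>measure_pmf p)"
  proof (rule Bochner_Integration.integral_cong[OF refl])
    fix z
    have "(LINT t|lborel. ?f t z) = (if z - x = 0 then 2 * pi else 0)"
      using integral_cos_int[of "z - x"] by (simp only: set_lebesgue_integral_def)
    then show "(LINT t|lborel. ?f t z) = 2 * pi * indicator {x} z" by (simp only:) simp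
  qed
  also have "\<dots> = 2 * pi * pmf p x"
    by (simp add: measure_pmf_single)
  finally have "(LINT t|lborel. (\<integral>z. ?f t z \<partial>measure_pmf p)) = 2 * pi * pmf p x" .
  moreover have "integrable lborel (\<lambda>t. \<integral>z. ?f t z \<partial>measure_pmf p)"
    using integrable_fst'[OF int] by simp
  ultimately show ?thesis by (simp add: has_bochner_integral_iff)
qed

text \<open>
  This makes the characteristic functions decay like a Gaussian on the whole period. The value
  \<open>1/12\<close> is what the Taylor remainder \<open>t^4 / 24\<close> leaves of \<open>t\<^sup>2 / 2\<close> when \<open>t\<^sup>2 \<le> \<pi>\<^sup>2 \<le> 10\<close>.
\<close>

lemma one_minus_cos_ge:
  fixes t :: real
  assumes "\<bar>t\<bar> \<le> pi"
  shows "1 - cos t \<ge> t\<^sup>2 / 12"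
proof -
  have app: "cmod (iexp t - (\<Sum>k\<le>3. (\<i> * t)^k / fact k)) \<le> \<bar>t\<bar>^4 / 24"
    using iexp_approx1[of t 3] by (simp add: fact_numeral)
  have Re: "Re (iexp t - (\<Sum>k\<le>3. (\<i> * t)^k / fact k)) = cos t - (1 - t\<^sup>2 / 2)"
    by (simp add: numeral_eq_Suc Re_exp power2_eq_square)
  have "\<bar>cos t - (1 - t\<^sup>2 / 2)\<bar> \<le> \<bar>t\<bar>^4 / 24"
    using order_trans[OF abs_Re_le_cmod app] unfolding Re .
  moreover have "\<bar>t\<bar>^4 \<le> 10 * t\<^sup>2"
  proof -
    have "pi\<^sup>2 \<le> (3.15::real)\<^sup>2"
      using pi_approx pi_gt_zero by (intro power_mono) (auto simp: abs_if split: if_splits)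
    moreover have "t\<^sup>2 \<le> pi\<^sup>2" using assms using abs_le_square_iff[of t pi] by simp
    ultimately have "t\<^sup>2 * t\<^sup>2 \<le> 10 * t\<^sup>2"
      by (intro mult_right_mono) (auto simp: power2_eq_square)
    then show ?thesis by (simp add: power2_eq_square power4_eq_xxxx abs_mult[symmetric])
  qed
  ultimately show ?thesis by (simp add: abs_if split: if_splits)
qed

lemma norm_exp_diff_le:
  fixes z w :: complex
  assumes "Re z \<le> c" "Re w \<le> c"
  shows "cmod (exp z - exp w) \<le> exp c * cmod (z - w)"
proof (rule field_differentiable_bound[where S = "{z. Re z \<le> c}" and f' = exp])
  show "(exp has_field_derivative exp z) (at z within {z. Re z \<le> c})" for z :: complex
    by (rule DERIV_subset[OF DERIV_exp]) simp
qed (use assms in \<open>auto simp: convex_halfspace_Re_le\<close>)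

section \<open>Entropy of the residue of an integer random variable\<close>

definition residue_entropy :: "int pmf \<Rightarrow> nat \<Rightarrow> real" where
  "residue_entropy p L = - (\<Sum>y\<in>{0..<int L}. pmf (map_pmf (\<lambda>x. x mod int L) p) y
      * ln (pmf (map_pmf (\<lambda>x. x mod int L) p) y))"

definition residue_prob :: "int pmf \<Rightarrow> nat \<Rightarrow> int \<Rightarrow> real" where
  "residue_prob p L y = measure_pmf.prob p {x. int L dvd x - y}"

lemma pmf_le_residue_prob: "pmf p x \<le> residue_prob p L x"
  unfolding residue_prob_def measure_pmf_single[symmetric]
  by (intro measure_pmf.finite_measure_mono) auto

lemma bij_betw_mod_window:
  assumes "L > 0"
  shows "bij_betw (\<lambda>x. x mod int L) {m..<m + int L} {0..<int L}"
proof (rule bij_betw_byWitness[where f' = "\<lambda>y. m + (y - m) mod int L"])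
  show "\<forall>x\<in>{m..<m + int L}. m + (x mod int L - m) mod int L = x"
    by (auto simp: mod_diff_left_eq)
  show "\<forall>y\<in>{0..<int L}. (m + (y - m) mod int L) mod int L = y"
    by (auto simp: mod_add_right_eq)
qed (use assms in auto)

text \<open>
  \<open>residue_prob p L\<close> is periodic, so the residues may be represented by any \<open>L\<close> consecutive
  integers; below they are chosen close to the mean.
\<close>

lemma residue_entropy_window:
  assumes "L > 0"
  shows "residue_entropy p L = (\<Sum>x\<in>{m..<m + int L}. - (residue_prob p L x * ln (residue_prob p L x)))"
proof -
  have "pmf (map_pmf (\<lambda>x. x mod int L) p) (y mod int L) = residue_prob p L y" for y
    unfolding pmf_map residue_prob_def
    by (intro arg_cong[where f = "measure_pmf.prob p"]) (auto simp: mod_eq_dvd_iff)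
  then show ?thesis
    unfolding residue_entropy_def
    by (subst sum.reindex_bij_betw[OF bij_betw_mod_window[OF assms, of m], symmetric])
       (simp add: sum_negf)
qed

lemma expectation_window:
  fixes f :: "int \<Rightarrow> real"
  assumes "L > 0"
  shows "(\<Sum>x\<in>{m..<m + int L}. residue_prob p L x * f x)
    = measure_pmf.expectation p (\<lambda>z. f (m + (z - m) mod int L))"
proof -
  let ?\<rho> = "\<lambda>z. m + (z - m) mod int L"
  have "pmf (map_pmf ?\<rho> p) x = residue_prob p L x" if x: "x \<in> {m..<m + int L}" for x
  proof -
    have "?\<rho> z = x \<longleftrightarrow> int L dvd z - x" for z
    proof -
      have "(x - m) mod int L = x - m" using x by simp
      then have "?\<rho> z = x \<longleftrightarrow> (z - m) mod int L = (x - m) mod int L" by auto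
      then show ?thesis by (simp add: mod_eq_dvd_iff)
    qed
    then show ?thesis
      unfolding pmf_map residue_prob_def by (intro arg_cong[where f = "measure_pmf.prob p"]) auto
  qed
  then have "(\<Sum>x\<in>{m..<m + int L}. residue_prob p L x * f x) = (\<Sum>x\<in>{m..<m + int L}. pmf (map_pmf ?\<rho> p) x *\<^sub>R f x)"
    by simp
  also have "\<dots> = measure_pmf.expectation (map_pmf ?\<rho> p) f"
    using assms by (intro integral_measure_pmf[symmetric]) auto
  finally show ?thesis by simp
qed

lemma sum_residue_prob: "L > 0 \<Longrightarrow> (\<Sum>x\<in>{m..<m + int L}. residue_prob p L x) = 1"
  using expectation_window[where p = p and L = L and m = m and f = "\<lambda>_. 1"] by simp

text \<open>
  Shannon entropy dominates min-entropy.
\<close>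

lemma entropy_ge_of_bound:
  assumes L: "L > 0" and B: "\<And>x. residue_prob p L x \<le> B" "B > 0"
  shows "residue_entropy p L \<ge> - ln B"
proof -
  have "- ln B = (\<Sum>x\<in>{0..<0 + int L}. residue_prob p L x * - ln B)"
    using sum_residue_prob[OF L, of p 0] by (simp only: sum_distrib_right[symmetric] mult_1_left add_0)
  also have "\<dots> \<le> (\<Sum>x\<in>{0..<0 + int L}. - (residue_prob p L x * ln (residue_prob p L x)))"
  proof (rule sum_mono)
    fix x
    show "residue_prob p L x * - ln B \<le> - (residue_prob p L x * ln (residue_prob p L x))"
    proof (cases "residue_prob p L x = 0")
      case False
      then have R: "residue_prob p L x > 0" by (simp add: residue_prob_def zero_less_measure_iff)
      then have "residue_prob p L x * ln (residue_prob p L x) \<le> residue_prob p L x * ln B"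
        using B by (intro mult_left_mono) auto
      then show ?thesis by simp
    qed simp
  qed
  also have "\<dots> = residue_entropy p L" by (rule residue_entropy_window[OF L, symmetric])
  finally show ?thesis .
qed

text \<open>
  The \<open>L\<close> consecutive integers closest to \<open>a\<close>.
\<close>

definition window :: "real \<Rightarrow> nat \<Rightarrow> int set" where
  "window a L = {\<lceil>a - real L / 2\<rceil>..<\<lceil>a - real L / 2\<rceil> + int L}"

lemma window_inside:
  assumes "x \<in> window a L"
  shows "\<bar>real_of_int x - a\<bar> \<le> real L / 2"
proof -
  have "\<lceil>a - real L / 2\<rceil> \<le> x" "x \<le> \<lceil>a - real L / 2\<rceil> + int L - 1"
    using assms by (auto simp: window_def)
  then have "real_of_int x \<le> real_of_int \<lceil>a - real L / 2\<rceil> + real L - 1" by linarith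
  then show ?thesis
    using \<open>\<lceil>a - real L / 2\<rceil> \<le> x\<close> ceiling_correct[of "a - real L / 2"]
    by (simp only: ceiling_le_iff) linarith
qed

lemma window_outside:
  assumes "x \<notin> window a L"
  shows "real L / 2 \<le> \<bar>real_of_int x - a\<bar>"
proof (cases "x < \<lceil>a - real L / 2\<rceil>")
  case True
  then show ?thesis by (simp add: less_ceiling_iff)
next
  case False
  then have "\<lceil>a - real L / 2\<rceil> \<le> x - int L" using assms by (auto simp: window_def)
  then show ?thesis by (simp add: ceiling_le_iff)
qed

section \<open>Local bounds for diffusive laws\<close>

text \<open>
  What the entropy estimates need to know about the law \<open>p\<close> on \<open>\<int>\<close> at time \<open>s\<close> with mean \<open>a\<close>.
  The characteristic function is \<open>exp (s * \<psi> t + i t a)\<close>, where \<open>\<psi>\<close> is the characteristic exponent of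
  one unit of time after centring; it is given through its real part with an arbitrary phase \<open>b\<close>,
  which keeps all integrals real. The real part of \<open>\<psi>\<close> governs the decay, and agreement with
  \<open>- t\<^sup>2 / 2\<close> up to third order makes the law locally Gaussian. The fourth moment gives uniform
  integrability of the square.
\<close>

locale diffusive_law =
  fixes p :: "int pmf" and a s :: real and \<psi> :: "real \<Rightarrow> complex"
  assumes s_pos: "s > 0"
    and cos_transform: "\<And>t b. measure_pmf.expectation p (\<lambda>x. cos (t * real_of_int x + b))
        = Re (cis (b + t * a) * exp (s * \<psi> t))"
    and Re_exponent: "\<And>t. Re (\<psi> t) = cos t - 1"
    and exponent_approx: "\<And>t. cmod (\<psi> t + complex_of_real (t\<^sup>2 / 2)) \<le> \<bar>t\<bar> ^ 3"
    and second_moment: "has_bochner_integral (measure_pmf p) (\<lambda>x. (real_of_int x - a)\<^sup>2) s"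
    and fourth_moment: "has_bochner_integral (measure_pmf p) (\<lambda>x. (real_of_int x - a) ^ 4) (3 * s\<^sup>2 + s)"

context diffusive_law
begin

text \<open>
  The Fourier coefficient of the walk at \<open>\<theta> k = 2 \<pi> k / L\<close> has modulus
  \<open>exp (- s (1 - cos (\<theta> k)))\<close>. With \<open>r\<close> the signed distance of \<open>k\<close> to the nearest multiple of \<open>L\<close>
  this is at most \<open>exp (- 3 s r\<^sup>2 / L\<^sup>2)\<close>, so the sum over all \<open>k\<close> is bounded by two Gaussian lattice
  sums, centred at \<open>0\<close> and at \<open>L\<close>.
\<close>

lemma residue_prob_le:
  assumes L: "L > 0"
  shows "residue_prob p L y \<le> 4 / real L + 3 / sqrt s"
proof -
  define \<theta> where "\<theta> = (\<lambda>k::nat. 2 * pi * real k / real L)"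
  define \<sigma> where "\<sigma> = (real L)\<^sup>2 / (6 * s)"
  have \<sigma>: "\<sigma> > 0" using L s_pos by (simp add: \<sigma>_def)
  have "real L * residue_prob p L y
      = measure_pmf.expectation p (\<lambda>x. real L * indicator {x. int L dvd x - y} x)"
    by (simp add: residue_prob_def)
  also have "\<dots> = measure_pmf.expectation p (\<lambda>x. \<Sum>k<L. cos (\<theta> k * real_of_int x + - (\<theta> k * real_of_int y)))"
  proof (rule Bochner_Integration.integral_cong)
    fix x
    have "(\<Sum>k<L. cos (\<theta> k * real_of_int x + - (\<theta> k * real_of_int y)))
        = (\<Sum>k<L. cos (2 * pi * real k / real L * real_of_int (x - y)))"
      by (simp add: \<theta>_def algebra_simps diff_divide_distrib)
    then show "real L * indicator {x. int L dvd x - y} x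
        = (\<Sum>k<L. cos (\<theta> k * real_of_int x + - (\<theta> k * real_of_int y)))"
      using sum_cos_residues[OF L, of "x - y"] by (simp add: indicator_def)
  qed simp
  also have "\<dots> = (\<Sum>k<L. measure_pmf.expectation p (\<lambda>x. cos (\<theta> k * real_of_int x + - (\<theta> k * real_of_int y))))"
    by (intro Bochner_Integration.integral_sum measure_pmf.integrable_const_bound[where B = 1]) auto
  also have "\<dots> \<le> (\<Sum>k<L. exp (- (real k - 0)\<^sup>2 / (2 * \<sigma>)) + exp (- (real k - real L)\<^sup>2 / (2 * \<sigma>)))"
  proof (rule sum_mono)
    fix k assume k: "k \<in> {..<L}"
    have "measure_pmf.expectation p (\<lambda>x. cos (\<theta> k * real_of_int x + - (\<theta> k * real_of_int y)))
        \<le> cmod (cis (- (\<theta> k * real_of_int y) + \<theta> k * a) * exp (s * \<psi> (\<theta> k)))"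
      unfolding cos_transform by (rule complex_Re_le_cmod)
    also have "\<dots> = exp (s * (cos (\<theta> k) - 1))"
      by (simp add: norm_mult Re_exponent)
    also have "\<dots> \<le> exp (- (real k - 0)\<^sup>2 / (2 * \<sigma>)) + exp (- (real k - real L)\<^sup>2 / (2 * \<sigma>))"
    proof -
      \<comment> \<open>The frequency is shifted by a period so that it lies in \<open>[-\<pi>, \<pi>]\<close>; \<open>r\<close> is \<open>k\<close> or \<open>k - L\<close>.\<close>
      have *: "exp (s * (cos (\<theta> k) - 1)) \<le> exp (- r\<^sup>2 / (2 * \<sigma>))"
        if r: "\<bar>r\<bar> \<le> real L / 2" "cos (2 * pi * r / real L) = cos (\<theta> k)" for r
      proof -
        have "\<bar>2 * pi * r / real L\<bar> = (2 * pi / real L) * \<bar>r\<bar>" by (simp add: abs_mult)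
        also have "\<dots> \<le> (2 * pi / real L) * (real L / 2)"
          using r by (intro mult_left_mono) auto
        also have "\<dots> = pi" using L by simp
        finally have "(2 * pi * r / real L)\<^sup>2 / 12 \<le> 1 - cos (\<theta> k)"
          using one_minus_cos_ge[of "2 * pi * r / real L"] r(2) by simp
        moreover have "3 * r\<^sup>2 / (real L)\<^sup>2 \<le> (2 * pi * r / real L)\<^sup>2 / 12"
        proof -
          have "3\<^sup>2 \<le> pi\<^sup>2" using pi_gt3 by (intro power_mono) auto
          then have "9 * (r\<^sup>2 / (real L)\<^sup>2) \<le> pi\<^sup>2 * (r\<^sup>2 / (real L)\<^sup>2)"
            by (intro mult_right_mono) auto
          then have "9 * (r\<^sup>2 / (real L)\<^sup>2) / 3 \<le> pi\<^sup>2 * (r\<^sup>2 / (real L)\<^sup>2) / 3"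
            by (rule divide_right_mono) simp
          moreover have "(2 * pi * r / real L)\<^sup>2 / 12 = pi\<^sup>2 * (r\<^sup>2 / (real L)\<^sup>2) / 3"
            by (simp add: power_divide power_mult_distrib)
          moreover have "3 * r\<^sup>2 / (real L)\<^sup>2 = 9 * (r\<^sup>2 / (real L)\<^sup>2) / 3" by simp
          ultimately show ?thesis by (simp only:)
        qed
        ultimately have "cos (\<theta> k) - 1 \<le> - (3 * r\<^sup>2 / (real L)\<^sup>2)" by linarith
        then have "s * (cos (\<theta> k) - 1) \<le> s * - (3 * r\<^sup>2 / (real L)\<^sup>2)"
          using s_pos by (intro mult_left_mono) auto
        also have "\<dots> = - r\<^sup>2 / (2 * \<sigma>)" using L s_pos by (simp add: \<sigma>_def field_simps)
        finally show ?thesis by simp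
      qed
      show ?thesis
      proof (cases "real k \<le> real L / 2")
        case True
        then have "exp (s * (cos (\<theta> k) - 1)) \<le> exp (- (real k - 0)\<^sup>2 / (2 * \<sigma>))"
          by (intro *) (auto simp: \<theta>_def)
        then show ?thesis by (rule order_trans) simp
      next
        case False
        have "2 * pi * (real k - real L) / real L = \<theta> k - 2 * pi"
          using L by (simp add: \<theta>_def field_simps)
        then have "cos (2 * pi * (real k - real L) / real L) = cos (\<theta> k)"
          by (simp add: cos_diff)
        then have "exp (s * (cos (\<theta> k) - 1)) \<le> exp (- (real k - real L)\<^sup>2 / (2 * \<sigma>))"
          using False k by (intro *) auto
        then show ?thesis by (rule order_trans) simp
      qed
    qed
    finally show "measure_pmf.expectation p (\<lambda>x. cos (\<theta> k * real_of_int x + - (\<theta> k * real_of_int y)))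
       \<le> exp (- (real k - 0)\<^sup>2 / (2 * \<sigma>)) + exp (- (real k - real L)\<^sup>2 / (2 * \<sigma>))" .
  qed
  also have "\<dots> \<le> (2 + sqrt (2 * pi * \<sigma>)) + (2 + sqrt (2 * pi * \<sigma>))"
  proof -
    have "(\<Sum>k<L. exp (- (real k - c)\<^sup>2 / (2 * \<sigma>))) \<le> 2 + sqrt (2 * pi * \<sigma>)" for c
      using gauss_lattice_sum_le[OF \<sigma>, of "int ` {..<L}" c] by (simp add: sum.reindex)
    then show ?thesis unfolding sum.distrib by (intro add_mono)
  qed
  also have "\<dots> = 4 + 2 * sqrt (2 * pi * \<sigma>)" by simp
  also have "2 * sqrt (2 * pi * \<sigma>) \<le> 3 * real L / sqrt s"
  proof (rule power2_le_imp_le)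
    have "4 * (2 * pi * \<sigma>) = (4 * pi / 3) * ((real L)\<^sup>2 / s)"
      by (simp add: \<sigma>_def)
    also have "\<dots> \<le> 9 * ((real L)\<^sup>2 / s)"
      using pi_less_4 s_pos by (intro mult_right_mono) auto
    finally show "(2 * sqrt (2 * pi * \<sigma>))\<^sup>2 \<le> (3 * real L / sqrt s)\<^sup>2"
      using \<sigma> s_pos by (simp add: power_mult_distrib power_divide)
  qed (use s_pos in simp)
  finally have "real L * residue_prob p L y \<le> 4 + 3 * real L / sqrt s" by simp
  then have "residue_prob p L y \<le> (4 + 3 * real L / sqrt s) / real L"
    using L by (simp add: pos_le_divide_eq mult.commute)
  also have "\<dots> = 4 / real L + 3 / sqrt s" using L by (simp add: field_simps)
  finally show ?thesis .
qed

text \<open>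
  One-sided local limit theorem with rate. In the inversion integral the characteristic function
  is replaced by \<open>exp (- s t\<^sup>2 / 2)\<close> at the cost of \<open>s \<bar>t\<bar>^3 exp (- s t\<^sup>2 / 12)\<close>, whose integral is of
  order \<open>1 / s\<close>, and the integral is extended from \<open>[-\<pi>, \<pi>]\<close> to the line at the cost of
  \<open>\<bar>t\<bar> exp (- s t\<^sup>2 / 2)\<close>. All three terms are collected in one integrable majorant \<open>F\<close>.
\<close>

lemma pmf_le_gauss:
  "pmf p x \<le> (exp (- (real_of_int x - a)\<^sup>2 / (2 * s)) + 72 / sqrt s) / sqrt (2 * pi * s)"
proof -
  define y where "y = a - real_of_int x"
  define F where "F = (\<lambda>t. cos (t * y) * exp (- (s * t\<^sup>2) / 2) + \<bar>t\<bar> * exp (- t\<^sup>2 / (2 * (sqrt (1 / s))\<^sup>2))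
      + s * (\<bar>t\<bar> ^ 3 * exp (- t\<^sup>2 / (2 * (sqrt (6 / s))\<^sup>2))))"
  have F: "has_bochner_integral lborel F
    (sqrt (2 * pi / s) * exp (- y\<^sup>2 / (2 * s)) + 2 * (sqrt (1 / s))\<^sup>2 + s * (4 * sqrt (6 / s) ^ 4))"
    unfolding F_def using s_pos
    by (intro has_bochner_integral_add has_bochner_integral_mult_right cos_integral_gauss abs_moment_gauss) auto
  have F_alt: "F t = cos (t * y) * exp (- (s * t\<^sup>2) / 2) + \<bar>t\<bar> * exp (- (s * t\<^sup>2) / 2)
      + s * \<bar>t\<bar> ^ 3 * exp (- (s * t\<^sup>2) / 12)" for t
    using s_pos by (simp add: F_def field_simps)
  let ?G = "\<lambda>t. measure_pmf.expectation p (\<lambda>z. cos (t * real_of_int (z - x)))"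
  have G: "?G t = Re (cis (t * y) * exp (s * \<psi> t))" for t
    using cos_transform[of t "- (t * real_of_int x)"] by (simp add: y_def algebra_simps)
  have GF: "indicator {-pi..pi} t * ?G t \<le> F t" for t
  proof (cases "\<bar>t\<bar> \<le> pi")
    case True
    have c: "cos t - 1 \<le> - (t\<^sup>2 / 12)" using one_minus_cos_ge[OF True] by simp
    have "Re (cis (t * y) * exp (s * \<psi> t)) - cos (t * y) * exp (- (s * t\<^sup>2) / 2)
       = Re (cis (t * y) * (exp (s * \<psi> t) - exp (complex_of_real (- (s * t\<^sup>2) / 2))))"
      by (simp add: Re_exp Im_exp algebra_simps)
    also have "\<dots> \<le> cmod (cis (t * y) * (exp (s * \<psi> t) - exp (complex_of_real (- (s * t\<^sup>2) / 2))))"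
      by (rule complex_Re_le_cmod)
    also have "\<dots> = cmod (exp (s * \<psi> t) - exp (complex_of_real (- (s * t\<^sup>2) / 2)))"
      by (simp add: norm_mult)
    also have "\<dots> \<le> exp (- (s * t\<^sup>2) / 12) * cmod (s * \<psi> t - complex_of_real (- (s * t\<^sup>2) / 2))"
    proof (rule norm_exp_diff_le)
      have "s * (cos t - 1) \<le> s * - (t\<^sup>2 / 12)" using c s_pos by (intro mult_left_mono) auto
      then show "Re (s * \<psi> t) \<le> - (s * t\<^sup>2) / 12" by (simp add: Re_exponent)
      show "Re (complex_of_real (- (s * t\<^sup>2) / 2)) \<le> - (s * t\<^sup>2) / 12" using s_pos by simp
    qed
    also have "s * \<psi> t - complex_of_real (- (s * t\<^sup>2) / 2) = complex_of_real s * (\<psi> t + complex_of_real (t\<^sup>2 / 2))"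
      by (simp add: algebra_simps)
    also have "cmod (complex_of_real s * (\<psi> t + complex_of_real (t\<^sup>2 / 2))) \<le> s * \<bar>t\<bar> ^ 3"
      using s_pos exponent_approx[of t] by (simp add: norm_mult)
    finally have "Re (cis (t * y) * exp (s * \<psi> t)) - cos (t * y) * exp (- (s * t\<^sup>2) / 2)
       \<le> s * \<bar>t\<bar> ^ 3 * exp (- (s * t\<^sup>2) / 12)" by (simp add: mult_ac)
    moreover have "0 \<le> \<bar>t\<bar> * exp (- (s * t\<^sup>2) / 2)" by simp
    moreover have "indicator {-pi..pi} t * ?G t = Re (cis (t * y) * exp (s * \<psi> t))"
      using True unfolding G by (auto simp: indicator_def)
    ultimately show ?thesis unfolding F_alt by linarith
  next
    case False
    \<comment> \<open>Outside the period \<open>\<bar>t\<bar> \<ge> 1\<close>, so the second term of \<open>F\<close> absorbs a negative cosine.\<close>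
    have "- (1 * exp (- (s * t\<^sup>2) / 2)) \<le> cos (t * y) * exp (- (s * t\<^sup>2) / 2)"
      using mult_right_mono[of "-1" "cos (t * y)" "exp (- (s * t\<^sup>2) / 2)"] by simp
    moreover have "1 * exp (- (s * t\<^sup>2) / 2) \<le> \<bar>t\<bar> * exp (- (s * t\<^sup>2) / 2)"
      using False pi_gt3 by (intro mult_right_mono) auto
    moreover have "0 \<le> s * \<bar>t\<bar> ^ 3 * exp (- (s * t\<^sup>2) / 12)" using s_pos by simp
    ultimately have "0 \<le> F t" unfolding F_alt by linarith
    moreover have "indicator {-pi..pi} t = (0::real)" using False by (auto simp: indicator_def)
    ultimately show ?thesis by simp
  qed
  have "2 * pi * pmf p x \<le> sqrt (2 * pi / s) * exp (- y\<^sup>2 / (2 * s)) + 2 * (sqrt (1 / s))\<^sup>2 + s * (4 * sqrt (6 / s) ^ 4)"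
    using integral_mono[of lborel "\<lambda>t. indicator {-pi..pi} t * ?G t" F] GF
      has_integral_pmf_cos[of p x] F unfolding has_bochner_integral_iff by simp
  also have "\<dots> = sqrt (2 * pi / s) * exp (- y\<^sup>2 / (2 * s)) + 146 / s"
  proof -
    have "sqrt (6 / s) ^ 4 = ((sqrt (6 / s))\<^sup>2)\<^sup>2" by (simp only: power_mult[symmetric]) simp
    then show ?thesis using s_pos by (simp add: power_divide) (simp add: field_simps power2_eq_square)
  qed
  finally have *: "2 * pi * pmf p x \<le> sqrt (2 * pi / s) * exp (- y\<^sup>2 / (2 * s)) + 146 / s" .
  define E where "E = exp (- y\<^sup>2 / (2 * s))"
  have root: "sqrt (2 * pi / s) = 2 * pi / sqrt (2 * pi * s)"
  proof -
    have "sqrt (2 * pi / s) * sqrt (2 * pi * s) = sqrt ((2 * pi)\<^sup>2)"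
      using s_pos unfolding real_sqrt_mult[symmetric] by (simp add: power2_eq_square)
    also have "\<dots> = 2 * pi" by (simp only: real_sqrt_abs) simp
    finally show ?thesis using s_pos by (simp add: eq_divide_eq)
  qed
  have "146 / s \<le> 2 * pi * (72 / sqrt s) / sqrt (2 * pi * s)"
  proof -
    have "sqrt (2 * pi) \<le> 3"
      using pi_less_4 by (intro real_le_lsqrt) auto
    then have "146 * sqrt (2 * pi) \<le> 144 * pi"
      using pi_approx by (simp add: abs_if split: if_splits)
    then have "146 * sqrt (2 * pi) / (sqrt (2 * pi) * s) \<le> 144 * pi / (sqrt (2 * pi) * s)"
      using s_pos by (intro divide_right_mono) auto
    moreover have "2 * pi * (72 / sqrt s) / sqrt (2 * pi * s) = 144 * pi / (sqrt (2 * pi) * s)"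
      using s_pos by (simp add: real_sqrt_mult field_simps)
    ultimately show ?thesis by simp
  qed
  with * have "2 * pi * pmf p x \<le> 2 * pi * ((E + 72 / sqrt s) / sqrt (2 * pi * s))"
    unfolding root E_def[symmetric] by (simp add: add_divide_distrib distrib_left)
  then have "pmf p x \<le> (E + 72 / sqrt s) / sqrt (2 * pi * s)"
    by (rule mult_left_le_imp_le) simp
  then show ?thesis by (simp add: E_def y_def power2_commute)
qed

end

section \<open>Entropy of diffusive laws\<close>

text \<open>
  Used with \<open>exp (- u)\<close> the Gaussian profile and \<open>\<epsilon>\<close> the uniform error of the local bound. Up to the
  cutoff \<open>M\<close> the perturbation costs at most \<open>\<epsilon> exp M\<close>; beyond it \<open>u - u\<^sup>2 / M\<close> is not positive, and the
  left-hand side is at least \<open>- \<epsilon>\<close>. Since the truncation is encoded in the term \<open>u\<^sup>2 / M\<close>, only the first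
  two moments of \<open>u\<close> enter afterwards.
\<close>

lemma neg_ln_add_ge:
  fixes u M \<epsilon> :: real
  assumes "u \<ge> 0" "M > 0" "\<epsilon> > 0"
  shows "- ln (exp (- u) + \<epsilon>) \<ge> u - u\<^sup>2 / M - \<epsilon> * exp M"
proof (cases "u \<le> M")
  case True
  have "exp (- u) + \<epsilon> = exp (- u) * (1 + \<epsilon> * exp u)"
    by (simp add: algebra_simps exp_minus)
  then have "ln (exp (- u) + \<epsilon>) = - u + ln (1 + \<epsilon> * exp u)"
    using assms by (simp only:) (subst ln_mult_pos, auto intro: add_pos_pos)
  also have "ln (1 + \<epsilon> * exp u) \<le> \<epsilon> * exp u"
    using assms by (intro ln_add_one_self_le_self) simp
  also have "\<epsilon> * exp u \<le> \<epsilon> * exp M" using True assms by simp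
  finally have "ln (exp (- u) + \<epsilon>) \<le> - u + \<epsilon> * exp M" by simp
  moreover have "u\<^sup>2 / M \<ge> 0" using assms by simp
  ultimately show ?thesis by linarith
next
  case False
  have "ln (exp (- u) + \<epsilon>) \<le> ln (1 + \<epsilon>)"
    using assms by (subst ln_le_cancel_iff) (auto intro: add_pos_pos)
  also have "\<dots> \<le> \<epsilon>" using assms by (intro ln_add_one_self_le_self) simp
  also have "\<dots> \<le> \<epsilon> * exp M" using assms by simp
  finally have "ln (exp (- u) + \<epsilon>) \<le> \<epsilon> * exp M" .
  moreover have "u * M \<le> u * u" using False assms by (intro mult_left_mono) auto
  then have "u \<le> u\<^sup>2 / M" using assms by (simp add: power2_eq_square pos_le_divide_eq)
  ultimately show ?thesis by linarith
qed

lemma ln_two_pi_le: "ln (2 * pi) \<le> 4"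
proof -
  have "ln (2 * pi) \<le> ln (3\<^sup>2)" using pi_less_4 by simp
  also have "\<dots> = 2 * ln 3" by (subst ln_realpow) auto
  also have "ln (3::real) \<le> 3 - 1" by (rule ln_le_minus_one) simp
  finally show ?thesis by simp
qed

context diffusive_law
begin

text \<open>
  The exponent of the Gaussian of mean \<open>a\<close> and variance \<open>s\<close>.
\<close>

definition gexp :: "int \<Rightarrow> real" where
  "gexp x = (real_of_int x - a)\<^sup>2 / (2 * s)"

lemma gexp_nonneg: "gexp x \<ge> 0"
  using s_pos by (simp add: gexp_def)

lemma gexp_moment: "has_bochner_integral (measure_pmf p) gexp (1 / 2)"
proof -
  have "has_bochner_integral (measure_pmf p) (\<lambda>x. (real_of_int x - a)\<^sup>2 / (2 * s)) (s / (2 * s))"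
    by (intro has_bochner_integral_divide_zero second_moment)
  then show ?thesis using s_pos by (simp add: gexp_def[abs_def])
qed

lemma gexp_sq_moment: "has_bochner_integral (measure_pmf p) (\<lambda>x. (gexp x)\<^sup>2) ((3 * s\<^sup>2 + s) / (4 * s\<^sup>2))"
proof -
  have "has_bochner_integral (measure_pmf p) (\<lambda>x. (real_of_int x - a) ^ 4 / (4 * s\<^sup>2)) ((3 * s\<^sup>2 + s) / (4 * s\<^sup>2))"
    by (intro has_bochner_integral_divide_zero fourth_moment)
  also have "(\<lambda>x. (real_of_int x - a) ^ 4 / (4 * s\<^sup>2)) = (\<lambda>x. (gexp x)\<^sup>2)"
    by (simp add: gexp_def power_divide power_mult_distrib power_mult[symmetric] fun_eq_iff)
  finally show ?thesis .
qed

text \<open>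
  Gibbs inequality against the Gaussian restricted to the window. The representative of \<open>z\<close> in the
  window is the point of its residue class nearest to \<open>a\<close>, so the exponent has mean at most its mean \<open>1/2\<close>
  under \<open>p\<close> itself.
\<close>

lemma entropy_le:
  assumes L: "L > 0"
  shows "residue_entropy p L \<le> 1 / 2 * ln (2 * pi * exp 1 * s) + 1 / sqrt s"
proof -
  let ?W = "window a L" and ?R = "residue_prob p L"
  define m where "m = \<lceil>a - real L / 2\<rceil>"
  have W: "?W = {m..<m + int L}" by (simp add: window_def m_def)
  have fin: "finite ?W" by (simp add: W)
  define Z where "Z = (\<Sum>x\<in>?W. exp (- gexp x))"
  have Z_pos: "Z > 0" unfolding Z_def by (rule sum_pos) (use L in \<open>auto simp: W\<close>)
  have R0: "?R x \<ge> 0" for x by (simp add: residue_prob_def)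
  have gibbs: "- (?R x * ln (?R x)) \<le> ?R x * gexp x + ?R x * ln Z + (exp (- gexp x) / Z - ?R x)" for x
  proof (cases "?R x = 0")
    case False
    then have R: "?R x > 0" using R0[of x] by simp
    let ?q = "exp (- gexp x) / Z"
    have "ln (?q / ?R x) \<le> ?q / ?R x - 1" using R Z_pos by (intro ln_le_minus_one) simp
    also have "ln (?q / ?R x) = - gexp x - ln Z - ln (?R x)"
      using R Z_pos by (simp only: ln_divide_pos divide_pos_pos exp_gt_zero ln_exp)
    finally have "?R x * (- gexp x - ln Z - ln (?R x)) \<le> ?R x * (?q / ?R x - 1)"
      using R by (intro mult_left_mono) auto
    also have "\<dots> = ?q - ?R x" using R by (simp add: field_simps)
    finally show ?thesis by (simp add: algebra_simps)
  qed (use Z_pos in simp)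
  have "residue_entropy p L \<le> (\<Sum>x\<in>?W. ?R x * gexp x + ?R x * ln Z + (exp (- gexp x) / Z - ?R x))"
    unfolding residue_entropy_window[OF L, of p m] W[symmetric] by (intro sum_mono gibbs)
  also have "\<dots> = (\<Sum>x\<in>?W. ?R x * gexp x) + (\<Sum>x\<in>?W. ?R x) * ln Z + (Z / Z - (\<Sum>x\<in>?W. ?R x))"
    unfolding sum.distrib sum_subtractf sum_distrib_right[symmetric] sum_divide_distrib[symmetric] Z_def[symmetric] ..
  also have "\<dots> = (\<Sum>x\<in>?W. ?R x * gexp x) + ln Z"
    using Z_pos sum_residue_prob[OF L, where m = m] by (simp add: W)
  also have "(\<Sum>x\<in>?W. ?R x * gexp x) \<le> 1 / 2"
  proof -
    \<comment> \<open>A point of the window is within \<open>L / 2\<close> of \<open>a\<close>, and a point outside is at least that far.\<close>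
    have near: "gexp (m + (z - m) mod int L) \<le> gexp z" for z
    proof -
      let ?r = "m + (z - m) mod int L"
      have r: "?r \<in> ?W" using L by (simp add: W)
      have "\<bar>real_of_int ?r - a\<bar> \<le> \<bar>real_of_int z - a\<bar>"
      proof (cases "z \<in> ?W")
        case True
        then have "?r = z" by (simp add: W)
        then show ?thesis by (simp only:)
      next
        case False
        then show ?thesis using window_inside[OF r] window_outside[OF False] by linarith
      qed
      then show ?thesis
        unfolding gexp_def using s_pos abs_le_square_iff[of "real_of_int ?r - a" "real_of_int z - a"]
        by (intro divide_right_mono) auto
    qed
    have "(\<Sum>x\<in>?W. ?R x * gexp x) = measure_pmf.expectation p (\<lambda>z. gexp (m + (z - m) mod int L))"
      unfolding W by (rule expectation_window[OF L])
    also have "\<dots> \<le> measure_pmf.expectation p gexp"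
      using gexp_moment by (intro integral_mono' near gexp_nonneg) (auto simp: has_bochner_integral_iff)
    finally show ?thesis using gexp_moment by (simp add: has_bochner_integral_iff)
  qed
  also have "ln Z \<le> 1 / 2 * ln (2 * pi * s) + 1 / sqrt s"
  proof -
    have q: "sqrt (2 * pi * s) > 0" using s_pos by simp
    have "Z \<le> 2 + sqrt (2 * pi * s)"
      using gauss_lattice_sum_le[OF s_pos fin, of a] by (simp add: Z_def gexp_def)
    then have "ln Z \<le> ln (2 + sqrt (2 * pi * s))" using Z_pos by (subst ln_le_cancel_iff) auto
    also have "2 + sqrt (2 * pi * s) = sqrt (2 * pi * s) * (1 + 2 / sqrt (2 * pi * s))"
    proof -
      have "2 + t = t * (1 + 2 / t)" if "t > 0" for t :: real
        using that by (simp add: field_simps)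
      then show ?thesis using q by blast
    qed
    also have "ln \<dots> = ln (sqrt (2 * pi * s)) + ln (1 + 2 / sqrt (2 * pi * s))"
      by (rule ln_mult_pos) (use q in \<open>auto intro!: add_pos_pos\<close>)
    also have "ln (sqrt (2 * pi * s)) = 1 / 2 * ln (2 * pi * s)"
      using s_pos by (simp add: ln_sqrt)
    also have "ln (1 + 2 / sqrt (2 * pi * s)) \<le> 2 / sqrt (2 * pi * s)"
      using q by (intro ln_add_one_self_le_self) simp
    also have "2 / sqrt (2 * pi * s) \<le> 1 / sqrt s"
    proof -
      have "2 * sqrt s = sqrt (4 * s)" by (simp add: real_sqrt_mult)
      also have "\<dots> \<le> sqrt (2 * pi * s)" using pi_gt3 s_pos by simp
      finally show ?thesis using s_pos q by (simp add: divide_simps)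
    qed
    finally show ?thesis by simp
  qed
  also have "1 / 2 + (1 / 2 * ln (2 * pi * s) + 1 / sqrt s) = 1 / 2 * ln (2 * pi * exp 1 * s) + 1 / sqrt s"
  proof -
    have "2 * pi * exp 1 * s = (2 * pi * s) * exp 1" by simp
    then have "ln (2 * pi * exp 1 * s) = ln (2 * pi * s) + 1"
      using s_pos by (simp only: ln_mult_pos[of "2 * pi * s" "exp 1"] mult_pos_pos pi_gt_zero zero_less_numeral
          exp_gt_zero ln_exp)
    then show ?thesis by simp
  qed
  finally show ?thesis by simp
qed

lemma ln_two_pi_e: "ln (2 * pi * exp 1 * s) = ln (2 * pi) + ln s + 1"
  using s_pos by (simp add: ln_mult)

lemma entropy_ge_coarse:
  assumes L: "L > 0"
  shows "residue_entropy p L \<ge> 1 / 2 * ln (2 * pi * exp 1 * s) - 5 - 4 * sqrt (s / (real L)\<^sup>2)"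
proof -
  define c where "c = s / (real L)\<^sup>2"
  have c: "sqrt c = sqrt s / real L" "sqrt c > 0"
    using L s_pos by (auto simp: c_def real_sqrt_divide)
  have eq: "4 / real L + 3 / sqrt s = (3 + 4 * sqrt c) / sqrt s"
    using L s_pos by (simp add: c field_simps)
  have "residue_entropy p L \<ge> - ln ((3 + 4 * sqrt c) / sqrt s)"
  proof (rule entropy_ge_of_bound[OF L])
    show "residue_prob p L x \<le> (3 + 4 * sqrt c) / sqrt s" for x
      unfolding eq[symmetric] by (rule residue_prob_le[OF L])
    show "(3 + 4 * sqrt c) / sqrt s > 0"
    proof (rule divide_pos_pos)
      show "3 + 4 * sqrt c > 0" using c(2) by linarith
    qed (use s_pos in simp)
  qed
  moreover have "ln ((3 + 4 * sqrt c) / sqrt s) = ln (3 + 4 * sqrt c) - 1 / 2 * ln s"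
  proof -
    have "3 + 4 * sqrt c > 0" using c(2) by linarith
    then have "ln ((3 + 4 * sqrt c) / sqrt s) = ln (3 + 4 * sqrt c) - ln (sqrt s)"
      using s_pos by (intro ln_divide_pos) auto
    then show ?thesis using s_pos by (simp add: ln_sqrt)
  qed
  moreover have "ln (3 + 4 * sqrt c) \<le> (3 + 4 * sqrt c) - 1"
    by (rule ln_le_minus_one) (use c(2) in linarith)
  ultimately show ?thesis using ln_two_pi_le unfolding ln_two_pi_e c_def[symmetric] distrib_left
    by linarith
qed

text \<open>
  Let \<open>R\<close> be the residue probability. Split \<open>- R ln R\<close> into \<open>- p ln R\<close> and \<open>- (R - p) ln R\<close>. The first
  part is at least \<open>- p ln p - (R - p)\<close>, where the local bound applies. In the second part
  \<open>- ln R\<close> is at least \<open>1/2 ln (2 \<pi> s) - 8\<close> by the uniform bound on \<open>R\<close>, so that the leading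
  coefficients of the two parts add up to \<open>\<Sum> R = 1\<close> and no factor \<open>ln s\<close> multiplies the mass \<open>\<Sum> (R - p)\<close>
  that has left the window.
\<close>

lemma entropy_ge_fine:
  assumes L: "L > 0" and s1: "s \<ge> 1" and sL: "s \<le> (real L)\<^sup>2" and M: "M > 0"
  shows "residue_entropy p L \<ge> 1 / 2 * ln (2 * pi * exp 1 * s)
    - 1 / M - 72 / sqrt s * exp M - 44 * (s / (real L)\<^sup>2)"
proof -
  let ?W = "window a L" and ?R = "residue_prob p L"
  define m where "m = \<lceil>a - real L / 2\<rceil>"
  define c where "c = s / (real L)\<^sup>2"
  define \<kappa> where "\<kappa> = 1 / 2 * ln (2 * pi * s)"
  define \<epsilon> where "\<epsilon> = 72 / sqrt s"
  have W: "?W = {m..<m + int L}" by (simp add: window_def m_def)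
  have fin: "finite ?W" by (simp add: W)
  have c_pos: "c > 0" and eps: "\<epsilon> > 0" using L s_pos by (auto simp: c_def \<epsilon>_def)
  have R0: "?R x \<ge> 0" for x by (simp add: residue_prob_def)
  have lam: "\<kappa> = 1 / 2 * ln (2 * pi) + 1 / 2 * ln s"
    using s_pos by (simp add: \<kappa>_def ln_mult)
  have Rsup: "\<kappa> - 8 \<le> - ln (?R x)" if "?R x > 0" for x
  proof -
    have "sqrt s \<le> real L" using sL by (intro real_le_lsqrt) auto
    then have "4 / real L \<le> 4 / sqrt s" using s_pos L by (intro divide_left_mono) auto
    then have "?R x \<le> 7 / sqrt s"
      using residue_prob_le[OF L, of x] by simp
    then have "ln (?R x) \<le> ln (7 / sqrt s)" using that s_pos by (subst ln_le_cancel_iff) auto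
    also have "\<dots> = ln 7 - 1 / 2 * ln s" using s_pos by (subst ln_divide_pos) (auto simp: ln_sqrt)
    also have "ln (7::real) \<le> 7 - 1" by (rule ln_le_minus_one) simp
    finally show ?thesis using ln_two_pi_le unfolding lam by simp
  qed
  \<comment> \<open>The constant 9 is 8 from the uniform bound plus 1 from \<open>ln (R / p) \<le> R / p - 1\<close>.\<close>
  have pointwise: "pmf p x * (\<kappa> + (gexp x - (gexp x)\<^sup>2 / M - \<epsilon> * exp M)) + (?R x - pmf p x) * (\<kappa> - 9)
      \<le> - (?R x * ln (?R x))" for x
  proof (cases "?R x = 0")
    case True
    then show ?thesis using pmf_le_residue_prob[of p x L] pmf_nonneg[of p x] by simp
  next
    case False
    then have R: "?R x > 0" using R0[of x] by simp
    have le: "pmf p x \<le> ?R x" by (rule pmf_le_residue_prob)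
    have "pmf p x * (\<kappa> + (gexp x - (gexp x)\<^sup>2 / M - \<epsilon> * exp M)) \<le> pmf p x * - ln (?R x) + (?R x - pmf p x)"
    proof (cases "pmf p x = 0")
      case False
      then have p0: "pmf p x > 0" by (simp add: pmf_positive_iff set_pmf_iff)
      have gp: "exp (- gexp x) + \<epsilon> > 0" using eps by (intro add_pos_pos) auto
      have "ln (pmf p x) \<le> ln ((exp (- gexp x) + \<epsilon>) / sqrt (2 * pi * s))"
        using pmf_le_gauss[of x] p0 gp s_pos by (subst ln_le_cancel_iff) (auto simp: gexp_def \<epsilon>_def)
      also have "\<dots> = ln (exp (- gexp x) + \<epsilon>) - \<kappa>"
        using gp s_pos by (subst ln_divide_pos) (auto simp: ln_sqrt \<kappa>_def)
      finally have 1: "\<kappa> + (gexp x - (gexp x)\<^sup>2 / M - \<epsilon> * exp M) \<le> - ln (pmf p x)"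
        using neg_ln_add_ge[OF gexp_nonneg[of x] M eps] by linarith
      have "ln (?R x / pmf p x) \<le> ?R x / pmf p x - 1" using R p0 by (intro ln_le_minus_one) simp
      then have "- ln (pmf p x) \<le> - ln (?R x) + (?R x / pmf p x - 1)"
        using R p0 by (simp add: ln_div)
      with 1 have "\<kappa> + (gexp x - (gexp x)\<^sup>2 / M - \<epsilon> * exp M) \<le> - ln (?R x) + (?R x / pmf p x - 1)"
        by linarith
      then have "pmf p x * (\<kappa> + (gexp x - (gexp x)\<^sup>2 / M - \<epsilon> * exp M)) \<le> pmf p x * (- ln (?R x) + (?R x / pmf p x - 1))"
        using p0 by (intro mult_left_mono) auto
      also have "\<dots> = pmf p x * - ln (?R x) + (?R x - pmf p x)"
        using p0 by (simp add: field_simps)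
      finally show ?thesis .
    qed (use R in simp)
    moreover have "(?R x - pmf p x) * (\<kappa> - 8) \<le> (?R x - pmf p x) * - ln (?R x)"
      using le Rsup[OF R] by (intro mult_left_mono) auto
    ultimately show ?thesis by (simp add: algebra_simps)
  qed
  define pW where "pW = measure_pmf.prob p ?W"
  have pW: "(\<Sum>x\<in>?W. pmf p x) = pW"
    using fin by (simp add: pW_def measure_measure_pmf_finite)
  have Rsum: "(\<Sum>x\<in>?W. ?R x) = 1" unfolding W by (rule sum_residue_prob[OF L])
  have gexp_out: "1 \<le> 8 * c * gexp x" if "x \<notin> ?W" for x
  proof -
    have "(real L / 2)\<^sup>2 \<le> \<bar>real_of_int x - a\<bar>\<^sup>2"
      using window_outside[OF that] by (intro power_mono) auto
    then have "(real L)\<^sup>2 \<le> 4 * (real_of_int x - a)\<^sup>2" by (simp add: power_divide)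
    then show ?thesis using L s_pos by (simp add: c_def gexp_def field_simps)
  qed
  have tail: "1 - pW \<le> 4 * c"
  proof -
    have "1 - pW = measure_pmf.prob p (- ?W)"
      unfolding pW_def using measure_pmf.prob_compl[of ?W p] by (simp add: Compl_eq_Diff_UNIV)
    also have "\<dots> = measure_pmf.expectation p (indicator (- ?W))" by simp
    also have "\<dots> \<le> measure_pmf.expectation p (\<lambda>x. 8 * c * gexp x)"
    proof (rule integral_mono')
      show "integrable (measure_pmf p) (\<lambda>x. 8 * c * gexp x)"
        using gexp_moment by (auto simp: has_bochner_integral_iff)
      show "indicator (- ?W) x \<le> 8 * c * gexp x" for x
        using gexp_out[of x] gexp_nonneg[of x] c_pos by (auto simp: indicator_def)
      show "0 \<le> 8 * c * gexp x" for x using gexp_nonneg[of x] c_pos by simp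
    qed
    also have "\<dots> = 4 * c" using gexp_moment by (simp add: has_bochner_integral_iff)
    finally show ?thesis .
  qed
  \<comment> \<open>The term \<open>8 * c * (gexp x)\<^sup>2\<close> is at least \<open>gexp x\<close> off the window, which allows the sum over the
    window to be replaced by an expectation over \<open>\<int>\<close>.\<close>
  have main: "1 / 2 - 1 / M - 8 * c \<le> (\<Sum>x\<in>?W. pmf p x * (gexp x - (gexp x)\<^sup>2 / M))"
  proof -
    define E2 where "E2 = (3 * s\<^sup>2 + s) / (4 * s\<^sup>2)"
    have "s \<le> s\<^sup>2" using s1 by (simp add: power2_eq_square)
    then have "E2 \<le> 1" using s_pos by (simp add: E2_def divide_le_eq)
    then have "E2 * (1 / M + 8 * c) \<le> 1 * (1 / M + 8 * c)"
      using M c_pos by (intro mult_right_mono) auto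
    then have "1 / 2 - 1 / M - 8 * c \<le> 1 / 2 - (1 / M + 8 * c) * E2" by (simp add: mult.commute)
    also have h: "has_bochner_integral (measure_pmf p) (\<lambda>x. gexp x - (1 / M + 8 * c) * (gexp x)\<^sup>2)
        (1 / 2 - (1 / M + 8 * c) * E2)"
      unfolding E2_def by (intro has_bochner_integral_diff has_bochner_integral_mult_right gexp_moment gexp_sq_moment)
    have "1 / 2 - (1 / M + 8 * c) * E2 = measure_pmf.expectation p (\<lambda>x. gexp x - (1 / M + 8 * c) * (gexp x)\<^sup>2)"
      using h by (simp add: has_bochner_integral_iff)
    also have "\<dots> \<le> measure_pmf.expectation p (\<lambda>x. indicator ?W x * (gexp x - (gexp x)\<^sup>2 / M))"
    proof (rule integral_mono)
      show "integrable (measure_pmf p) (\<lambda>x. gexp x - (1 / M + 8 * c) * (gexp x)\<^sup>2)"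
        using h by (simp add: has_bochner_integral_iff)
      have "integrable (measure_pmf p) (\<lambda>x. gexp x - (gexp x)\<^sup>2 / M)"
        using gexp_moment gexp_sq_moment by (intro Bochner_Integration.integrable_diff integrable_divide)
          (auto simp: has_bochner_integral_iff)
      from integrable_mult_indicator[OF _ this, of ?W]
      show "integrable (measure_pmf p) (\<lambda>x. indicator ?W x * (gexp x - (gexp x)\<^sup>2 / M))" by simp
      show "gexp x - (1 / M + 8 * c) * (gexp x)\<^sup>2 \<le> indicator ?W x * (gexp x - (gexp x)\<^sup>2 / M)" for x
      proof (cases "x \<in> ?W")
        case True
        have "0 \<le> 8 * c * (gexp x)\<^sup>2" using c_pos by simp
        then show ?thesis using True by (simp add: algebra_simps)
      next
        case False
        have "gexp x * 1 \<le> gexp x * (8 * c * gexp x)"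
          using gexp_out[OF False] gexp_nonneg[of x] by (intro mult_left_mono) auto
        moreover have "0 \<le> (gexp x)\<^sup>2 / M" using M by simp
        ultimately show ?thesis using False by (simp add: algebra_simps power2_eq_square)
      qed
    qed
    also have "\<dots> = (\<Sum>x\<in>?W. pmf p x *\<^sub>R (indicator ?W x * (gexp x - (gexp x)\<^sup>2 / M)))"
      using fin by (intro integral_measure_pmf) (auto simp: indicator_def)
    finally show ?thesis by simp
  qed
  have "1 / 2 * ln (2 * pi * exp 1 * s) = \<kappa> + 1 / 2"
    unfolding lam ln_two_pi_e by (simp add: algebra_simps)
  then have "1 / 2 * ln (2 * pi * exp 1 * s) - 1 / M - 72 / sqrt s * exp M - 44 * (s / (real L)\<^sup>2)
      = \<kappa> + (1 / 2 - 1 / M - 8 * c) - \<epsilon> * exp M - 9 * (4 * c)"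
    by (simp add: c_def \<epsilon>_def)
  also have "\<dots> \<le> \<kappa> + (\<Sum>x\<in>?W. pmf p x * (gexp x - (gexp x)\<^sup>2 / M)) - pW * (\<epsilon> * exp M) - 9 * (1 - pW)"
  proof -
    have "pW * (\<epsilon> * exp M) \<le> 1 * (\<epsilon> * exp M)"
      using eps by (intro mult_right_mono) (auto simp: pW_def)
    moreover have "9 * (1 - pW) \<le> 9 * (4 * c)" using tail by simp
    ultimately show ?thesis using main by (intro diff_mono add_mono) auto
  qed
  also have "\<dots> = (\<Sum>x\<in>?W. pmf p x * (\<kappa> + (gexp x - (gexp x)\<^sup>2 / M - \<epsilon> * exp M)) + (?R x - pmf p x) * (\<kappa> - 9))"
  proof -
    have "(\<Sum>x\<in>?W. pmf p x * (\<kappa> + (gexp x - (gexp x)\<^sup>2 / M - \<epsilon> * exp M)) + (?R x - pmf p x) * (\<kappa> - 9))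
      = (\<Sum>x\<in>?W. pmf p x * (gexp x - (gexp x)\<^sup>2 / M) + pmf p x * (9 - \<epsilon> * exp M) + ?R x * (\<kappa> - 9))"
      by (intro sum.cong refl) (simp add: algebra_simps)
    also have "\<dots> = (\<Sum>x\<in>?W. pmf p x * (gexp x - (gexp x)\<^sup>2 / M)) + pW * (9 - \<epsilon> * exp M) + 1 * (\<kappa> - 9)"
      unfolding sum.distrib sum_distrib_right[symmetric] pW Rsum ..
    finally show ?thesis by (simp add: algebra_simps)
  qed
  also have "\<dots> \<le> (\<Sum>x\<in>?W. - (?R x * ln (?R x)))"
    by (intro sum_mono pointwise)
  also have "\<dots> = residue_entropy p L"
    unfolding W by (rule residue_entropy_window[OF L, symmetric])
  finally show ?thesis .
qed

text \<open>
  For \<open>s \<ge> 1\<close> and \<open>s \<le> L\<^sup>2\<close> the cutoff is \<open>M = ln (1 + s) / 4\<close>: then \<open>exp M\<close> is of order \<open>s\<close> to the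
  power \<open>1/4\<close>, so \<open>exp M / sqrt s\<close> vanishes and the slowest error term is \<open>1 / M\<close>. In all other cases the
  right-hand side exceeds \<open>5 + 4 sqrt (s / L\<^sup>2)\<close> and the coarse bound suffices.
\<close>

theorem entropy_error:
  assumes L: "L > 0"
  shows "\<bar>residue_entropy p L - 1 / 2 * ln (2 * pi * exp 1 * s)\<bar>
     \<le> 436 / ln (1 + s) + 44 * (sqrt (s / (real L)\<^sup>2) + s / (real L)\<^sup>2)"
proof -
  define c where "c = s / (real L)\<^sup>2"
  have c: "c > 0" "sqrt c > 0" using L s_pos by (auto simp: c_def)
  have ln_pos: "ln (1 + s) > 0" using s_pos by simp
  have ln_le: "ln (1 + s) \<le> 2 * sqrt s"
  proof -
    have "1 + s \<le> (1 + sqrt s)\<^sup>2" using s_pos by (simp add: power2_eq_square algebra_simps)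
    then have "ln (1 + s) \<le> ln ((1 + sqrt s)\<^sup>2)" using s_pos by (subst ln_le_cancel_iff) auto
    also have "\<dots> = 2 * ln (1 + sqrt s)" using s_pos by (simp add: ln_realpow add_pos_pos)
    also have "ln (1 + sqrt s) \<le> sqrt s" using s_pos by (intro ln_add_one_self_le_self) simp
    finally show ?thesis by simp
  qed
  have upper: "residue_entropy p L - 1 / 2 * ln (2 * pi * exp 1 * s) \<le> 436 / ln (1 + s) + 44 * (sqrt c + c)"
  proof -
    have "1 / sqrt s \<le> 436 / ln (1 + s)"
    proof -
      have "ln (1 + s) \<le> 436 * sqrt s" using ln_le real_sqrt_gt_zero[OF s_pos] by linarith
      then show ?thesis using ln_pos s_pos by (simp add: divide_simps)
    qed
    moreover have "0 \<le> 44 * (sqrt c + c)" using c by simp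
    ultimately show ?thesis using entropy_le[OF L] by linarith
  qed
  have lower: "- (436 / ln (1 + s) + 44 * (sqrt c + c)) \<le> residue_entropy p L - 1 / 2 * ln (2 * pi * exp 1 * s)"
  proof (cases "s \<ge> 1 \<and> c \<le> 1")
    case True
    define M where "M = ln (1 + s) / 4"
    have M: "M > 0" using ln_pos by (simp add: M_def)
    have sL: "s \<le> (real L)\<^sup>2" using True L by (simp add: c_def divide_le_eq)
    have "72 / sqrt s * exp M \<le> 432 / ln (1 + s)"
    proof -
      have "ln (1 + s) \<le> 4 * exp M"
      proof -
        have "ln (1 + s) = 4 * M" by (simp add: M_def)
        then show ?thesis using exp_ge_add_one_self[of M] by linarith
      qed
      then have "exp M * ln (1 + s) \<le> exp M * (4 * exp M)" by (intro mult_left_mono) auto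
      also have "exp M * (4 * exp M) = 4 * exp (ln (1 + s) / 2)"
        by (simp add: M_def exp_add[symmetric])
      also have "exp (ln (1 + s) / 2) = sqrt (1 + s)"
        using s_pos by (subst ln_sqrt[symmetric]) auto
      also have "4 * sqrt (1 + s) \<le> 6 * sqrt s"
      proof (rule power2_le_imp_le)
        show "(4 * sqrt (1 + s))\<^sup>2 \<le> (6 * sqrt s)\<^sup>2"
          using True by (simp add: power_mult_distrib)
      qed (use s_pos in simp)
      finally have "exp M * ln (1 + s) \<le> 6 * sqrt s" by simp
      then show ?thesis using ln_pos s_pos by (simp add: divide_simps)
    qed
    moreover have "1 / M = 4 / ln (1 + s)" by (simp add: M_def)
    moreover have "436 / ln (1 + s) = 4 / ln (1 + s) + 432 / ln (1 + s)"
      by (simp add: add_divide_distrib[symmetric])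
    moreover have "0 \<le> 44 * sqrt c" using c(2) by linarith
    ultimately show ?thesis
      using entropy_ge_fine[OF L conjunct1[OF True] sL M]
      unfolding c_def[symmetric] distrib_left by linarith
  next
    case False
    have "5 \<le> 436 / ln (1 + s) + 5 * c"
    proof (cases "s \<ge> 1")
      case True
      then have "1 \<le> c" using False by simp
      then show ?thesis using ln_pos by (simp add: add_increasing)
    next
      case False
      then have "ln (1 + s) \<le> 1" using ln_add_one_self_le_self[of s] s_pos by simp
      then have "5 \<le> 436 / ln (1 + s)" using ln_pos by (simp add: le_divide_eq)
      then show ?thesis using c by linarith
    qed
    then show ?thesis
      using entropy_ge_coarse[OF L] c unfolding c_def[symmetric] distrib_left by linarith
  qed
  show ?thesis using upper lower unfolding c_def[symmetric] by linarith
qed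

end

section \<open>Moments of the Poisson distribution\<close>

lemma has_bochner_integral_pmf_nat_iff:
  fixes p :: "nat pmf" and f :: "nat \<Rightarrow> real"
  shows "has_bochner_integral (measure_pmf p) f I \<longleftrightarrow>
    summable (\<lambda>n. \<bar>pmf p n * f n\<bar>) \<and> (\<lambda>n. pmf p n * f n) sums I"
proof -
  have "has_bochner_integral (measure_pmf p) f I \<longleftrightarrow>
      has_bochner_integral (count_space UNIV) (\<lambda>n. pmf p n * f n) I"
    unfolding measure_pmf_eq_density has_bochner_integral_iff
    by (simp add: integrable_density integral_density)
  also have "\<dots> \<longleftrightarrow> summable (\<lambda>n. \<bar>pmf p n * f n\<bar>) \<and> (\<lambda>n. pmf p n * f n) sums I"
    by (auto simp: has_bochner_integral_iff integrable_count_space_nat_iff integral_count_space_nat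
        sums_iff summable_rabs_cancel)
  finally show ?thesis .
qed

text \<open>
  The Chen-Stein identity: \<open>n\<close> times the weight at \<open>n\<close> is \<open>s\<close> times the weight at \<open>n - 1\<close>. It yields all
  Poisson moments recursively.
\<close>

lemma poisson_shift:
  assumes "s > 0" "has_bochner_integral (measure_pmf (poisson_pmf s)) (\<lambda>n. f (Suc n)) I"
  shows "has_bochner_integral (measure_pmf (poisson_pmf s)) (\<lambda>n. real n * f n) (s * I)"
proof -
  let ?g = "\<lambda>n. pmf (poisson_pmf s) n * (real n * f n)"
  have g: "?g (Suc n) = s * (pmf (poisson_pmf s) n * f (Suc n))" for n
    using assms(1) by (simp add: pmf_poisson divide_simps)
  have *: "summable (\<lambda>n. \<bar>pmf (poisson_pmf s) n * f (Suc n)\<bar>)"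
    "(\<lambda>n. pmf (poisson_pmf s) n * f (Suc n)) sums I"
    using assms(2) unfolding has_bochner_integral_pmf_nat_iff by auto
  have "summable (\<lambda>n. \<bar>?g (Suc n)\<bar>)"
    unfolding g abs_mult[of s] by (intro summable_mult *)
  then have "summable (\<lambda>n. \<bar>?g n\<bar>)" by (subst (asm) summable_Suc_iff)
  moreover have "(\<lambda>n. ?g (Suc n)) sums (s * I)"
    unfolding g by (intro sums_mult *)
  then have "?g sums (s * I)" by (subst (asm) sums_Suc_iff) simp
  ultimately show ?thesis unfolding has_bochner_integral_pmf_nat_iff by blast
qed

lemma poisson_moments:
  assumes s: "s > 0"
  shows "has_bochner_integral (measure_pmf (poisson_pmf s)) (\<lambda>n. real n) s"
    and "has_bochner_integral (measure_pmf (poisson_pmf s)) (\<lambda>n. real n ^ 2) (s\<^sup>2 + s)"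
    and "has_bochner_integral (measure_pmf (poisson_pmf s)) (\<lambda>n. real n ^ 3) (s ^ 3 + 3 * s\<^sup>2 + s)"
    and "has_bochner_integral (measure_pmf (poisson_pmf s)) (\<lambda>n. real n ^ 4) (s ^ 4 + 6 * s ^ 3 + 7 * s\<^sup>2 + s)"
proof -
  let ?P = "measure_pmf (poisson_pmf s)"
  have 0: "has_bochner_integral ?P (\<lambda>n. 1::real) 1"
    by (simp add: has_bochner_integral_iff)
  from poisson_shift[OF s, where f = "\<lambda>_. 1", OF 0]
  show 1: "has_bochner_integral ?P (\<lambda>n. real n) s" by simp
  have "has_bochner_integral ?P (\<lambda>n. real (Suc n)) (s + 1)"
    using has_bochner_integral_add[OF 1 0] by (simp add: add.commute)
  from poisson_shift[OF s, where f = real, OF this]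
  show 2: "has_bochner_integral ?P (\<lambda>n. real n ^ 2) (s\<^sup>2 + s)"
    by (simp add: power2_eq_square algebra_simps)
  have "has_bochner_integral ?P (\<lambda>n. real n ^ 2 + 2 * real n + 1) (s\<^sup>2 + s + 2 * s + 1)"
    by (intro has_bochner_integral_add has_bochner_integral_mult_right 0 1 2)
  then have "has_bochner_integral ?P (\<lambda>n. real (Suc n) ^ 2) (s\<^sup>2 + 3 * s + 1)"
    by (simp add: power2_eq_square algebra_simps)
  from poisson_shift[OF s, where f = "\<lambda>n. real n ^ 2", OF this]
  show 3: "has_bochner_integral ?P (\<lambda>n. real n ^ 3) (s ^ 3 + 3 * s\<^sup>2 + s)"
    by (simp add: power2_eq_square power3_eq_cube algebra_simps)
  have "has_bochner_integral ?P (\<lambda>n. real n ^ 3 + 3 * real n ^ 2 + 3 * real n + 1)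
      (s ^ 3 + 3 * s\<^sup>2 + s + 3 * (s\<^sup>2 + s) + 3 * s + 1)"
    by (intro has_bochner_integral_add has_bochner_integral_mult_right 0 1 2 3)
  then have "has_bochner_integral ?P (\<lambda>n. real (Suc n) ^ 3) (s ^ 3 + 6 * s\<^sup>2 + 7 * s + 1)"
    by (simp add: power2_eq_square power3_eq_cube algebra_simps)
  from poisson_shift[OF s, where f = "\<lambda>n. real n ^ 3", OF this]
  show "has_bochner_integral ?P (\<lambda>n. real n ^ 4) (s ^ 4 + 6 * s ^ 3 + 7 * s\<^sup>2 + s)"
    by (simp add: power2_eq_square power3_eq_cube power4_eq_xxxx algebra_simps)
qed

lemma poisson_central_moments:
  assumes s: "s > 0"
  shows "has_bochner_integral (measure_pmf (poisson_pmf s)) (\<lambda>n. (real n - s) ^ 2) s"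
    and "has_bochner_integral (measure_pmf (poisson_pmf s)) (\<lambda>n. (real n - s) ^ 4) (3 * s\<^sup>2 + s)"
proof -
  let ?P = "measure_pmf (poisson_pmf s)"
  note m = poisson_moments[OF s]
  have 0: "has_bochner_integral ?P (\<lambda>n. c) c" for c :: real
    by (simp add: has_bochner_integral_iff)
  have "has_bochner_integral ?P (\<lambda>n. real n ^ 2 + (- 2 * s) * real n + s\<^sup>2) (s\<^sup>2 + s + (- 2 * s) * s + s\<^sup>2)"
    by (intro has_bochner_integral_add has_bochner_integral_mult_right 0 m)
  then show "has_bochner_integral ?P (\<lambda>n. (real n - s) ^ 2) s"
    by (simp add: power2_eq_square algebra_simps)
  have "has_bochner_integral ?P
      (\<lambda>n. real n ^ 4 + (- 4 * s) * real n ^ 3 + (6 * s\<^sup>2) * real n ^ 2 + (- 4 * s ^ 3) * real n + s ^ 4)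
      (s ^ 4 + 6 * s ^ 3 + 7 * s\<^sup>2 + s + (- 4 * s) * (s ^ 3 + 3 * s\<^sup>2 + s)
        + (6 * s\<^sup>2) * (s\<^sup>2 + s) + (- 4 * s ^ 3) * s + s ^ 4)"
    by (intro has_bochner_integral_add has_bochner_integral_mult_right 0 m)
  then show "has_bochner_integral ?P (\<lambda>n. (real n - s) ^ 4) (3 * s\<^sup>2 + s)"
    by (simp add: power2_eq_square power3_eq_cube power4_eq_xxxx algebra_simps)
qed

section \<open>The walks before reduction modulo L\<close>

definition int_walk :: "int pmf \<Rightarrow> real \<Rightarrow> int pmf" where
  "int_walk \<xi> s = bind_pmf (poisson_pmf s) (\<lambda>n. map_pmf sum_list (replicate_pmf n \<xi>))"

lemma walk_law_eq_map: "walk_law \<xi> L s = map_pmf (\<lambda>x. x mod int L) (int_walk \<xi> s)"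
  by (simp add: walk_law_def int_walk_def map_bind_pmf pmf.map_comp o_def)

lemma finite_set_replicate_pmf: "finite (set_pmf p) \<Longrightarrow> finite (set_pmf (replicate_pmf n p))"
  by (induction n) auto

lemma replicate_return_pmf: "replicate_pmf n (return_pmf x) = return_pmf (replicate n x)"
  by (induction n) (simp_all add: bind_return_pmf)

text \<open>
  For nonnegative \<open>h\<close> the integral may be computed by conditioning on the number \<open>n\<close> of jumps, and
  integrability comes for free.
\<close>

lemma int_walk_has_integral:
  fixes h :: "int \<Rightarrow> real"
  assumes "finite (set_pmf \<xi>)" "\<And>x. h x \<ge> 0"
    and m: "\<And>n. measure_pmf.expectation (replicate_pmf n \<xi>) (\<lambda>js. h (sum_list js)) = m n"
    and I: "has_bochner_integral (measure_pmf (poisson_pmf s)) m I"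
  shows "has_bochner_integral (measure_pmf (int_walk \<xi> s)) h I"
proof (rule has_bochner_integral_nn_integral)
  have m0: "m n \<ge> 0" for n
    unfolding m[symmetric] using assms(2) by simp
  then show "I \<ge> 0"
    using has_bochner_integral_integral_eq[OF I] Bochner_Integration.integral_nonneg[of "measure_pmf (poisson_pmf s)" m] by simp
  have "(\<integral>\<^sup>+ x. ennreal (h x) \<partial>measure_pmf (int_walk \<xi> s)) =
     (\<integral>\<^sup>+ n. (\<integral>\<^sup>+ js. ennreal (h (sum_list js)) \<partial>measure_pmf (replicate_pmf n \<xi>)) \<partial>measure_pmf (poisson_pmf s))"
    by (simp add: int_walk_def)
  also have "\<dots> = (\<integral>\<^sup>+ n. ennreal (m n) \<partial>measure_pmf (poisson_pmf s))"
    unfolding m[symmetric] using assms(1,2)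
    by (intro nn_integral_cong nn_integral_eq_integral integrable_measure_pmf_finite
        finite_set_replicate_pmf) auto
  also have "\<dots> = ennreal I"
    using I m0 by (simp add: nn_integral_eq_integral has_bochner_integral_iff)
  finally show "(\<integral>\<^sup>+ x. ennreal (h x) \<partial>measure_pmf (int_walk \<xi> s)) = ennreal I" .
qed (use assms in auto)

text \<open>
  Conditioning on one jump of size \<open>\<plusminus>1\<close>, the second moment increases by \<open>1\<close> and the fourth by six times
  the second plus \<open>1\<close>.
\<close>

lemma simple_walk_moments:
  "measure_pmf.expectation (replicate_pmf n simple_step) (\<lambda>js. (real_of_int (sum_list js))\<^sup>2) = real n"
  "measure_pmf.expectation (replicate_pmf n simple_step) (\<lambda>js. (real_of_int (sum_list js)) ^ 4)
     = 3 * (real n)\<^sup>2 - 2 * real n"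
proof -
  have fin [simp]: "finite (set_pmf (replicate_pmf n simple_step))" for n
    by (rule finite_set_replicate_pmf) (simp add: simple_step_def)
  have int [simp]: "integrable (measure_pmf (replicate_pmf n simple_step)) f" for n and f :: "int list \<Rightarrow> real"
    by (rule integrable_measure_pmf_finite) simp
  have step: "measure_pmf.expectation (replicate_pmf (Suc n) simple_step) (\<lambda>js. f (sum_list js)) =
    (measure_pmf.expectation (replicate_pmf n simple_step) (\<lambda>js. f (sum_list js + 1)) +
     measure_pmf.expectation (replicate_pmf n simple_step) (\<lambda>js. f (sum_list js - 1))) / 2"
    for n and f :: "int \<Rightarrow> real"
  proof -
    have "replicate_pmf (Suc n) simple_step =
        pmf_of_set {1, -1} \<bind> (\<lambda>j. map_pmf ((#) j) (replicate_pmf n simple_step))"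
      by (simp add: simple_step_def map_pmf_def)
    then show ?thesis
      by (simp only:) (subst pmf_expectation_bind_pmf_of_set, auto simp: add_ac field_simps)
  qed
  show 2: "measure_pmf.expectation (replicate_pmf n simple_step) (\<lambda>js. (real_of_int (sum_list js))\<^sup>2) = real n" for n
  proof (induction n)
    case (Suc n)
    show ?case
      by (subst step[where f = "\<lambda>x. (real_of_int x)\<^sup>2"])
        (simp add: power2_sum power2_diff Suc.IH)
  qed simp
  show "measure_pmf.expectation (replicate_pmf n simple_step) (\<lambda>js. (real_of_int (sum_list js)) ^ 4)
     = 3 * (real n)\<^sup>2 - 2 * real n"
  proof (induction n)
    case (Suc n)
    let ?E = "measure_pmf.expectation (replicate_pmf n simple_step)"
    have "measure_pmf.expectation (replicate_pmf (Suc n) simple_step) (\<lambda>js. (real_of_int (sum_list js)) ^ 4)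
      = (?E (\<lambda>js. (real_of_int (sum_list js + 1)) ^ 4) + ?E (\<lambda>js. (real_of_int (sum_list js - 1)) ^ 4)) / 2"
      by (rule step)
    also have "\<dots> = ?E (\<lambda>js. ((real_of_int (sum_list js + 1)) ^ 4 + (real_of_int (sum_list js - 1)) ^ 4) / 2)"
      by simp
    also have "\<dots> = ?E (\<lambda>js. (real_of_int (sum_list js)) ^ 4 + 6 * (real_of_int (sum_list js))\<^sup>2 + 1)"
      by (rule Bochner_Integration.integral_cong)
        (simp_all add: power4_eq_xxxx power2_eq_square algebra_simps)
    also have "\<dots> = 3 * (real (Suc n))\<^sup>2 - 2 * real (Suc n)"
      by (simp add: 2 Suc.IH) (simp add: power2_eq_square algebra_simps)
    finally show ?case .
  qed simp
qed

lemma int_walk_moments_simple: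
  assumes s: "s > 0"
  shows "has_bochner_integral (measure_pmf (int_walk simple_step s)) (\<lambda>x. (real_of_int x)\<^sup>2) s"
    and "has_bochner_integral (measure_pmf (int_walk simple_step s)) (\<lambda>x. (real_of_int x) ^ 4) (3 * s\<^sup>2 + s)"
proof -
  have fin: "finite (set_pmf simple_step)" by (simp add: simple_step_def)
  show "has_bochner_integral (measure_pmf (int_walk simple_step s)) (\<lambda>x. (real_of_int x)\<^sup>2) s"
    by (rule int_walk_has_integral[OF fin _ simple_walk_moments(1) poisson_moments(1)[OF s]]) simp
  have "has_bochner_integral (measure_pmf (poisson_pmf s)) (\<lambda>n. 3 * real n ^ 2 - 2 * real n) (3 * (s\<^sup>2 + s) - 2 * s)"
    by (intro has_bochner_integral_diff has_bochner_integral_mult_right poisson_moments s)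
  then have "has_bochner_integral (measure_pmf (poisson_pmf s)) (\<lambda>n. 3 * real n ^ 2 - 2 * real n) (3 * s\<^sup>2 + s)"
    by (simp add: algebra_simps)
  then show "has_bochner_integral (measure_pmf (int_walk simple_step s)) (\<lambda>x. (real_of_int x) ^ 4) (3 * s\<^sup>2 + s)"
    by (rule int_walk_has_integral[OF fin _ simple_walk_moments(2), rotated]) simp
qed

lemma int_walk_moments_directed:
  assumes s: "s > 0"
  shows "has_bochner_integral (measure_pmf (int_walk directed_step s)) (\<lambda>x. (real_of_int x - s)\<^sup>2) s"
    and "has_bochner_integral (measure_pmf (int_walk directed_step s)) (\<lambda>x. (real_of_int x - s) ^ 4) (3 * s\<^sup>2 + s)"
proof -
  have fin: "finite (set_pmf directed_step)" by (simp add: directed_step_def)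
  have *: "measure_pmf.expectation (replicate_pmf n directed_step) (\<lambda>js. f (sum_list js)) = f (int n)"
    for n and f :: "int \<Rightarrow> real"
    by (simp add: directed_step_def replicate_return_pmf sum_list_replicate)
  show "has_bochner_integral (measure_pmf (int_walk directed_step s)) (\<lambda>x. (real_of_int x - s)\<^sup>2) s"
    by (rule int_walk_has_integral[OF fin _ *[where f = "\<lambda>x. (real_of_int x - s)\<^sup>2"]])
       (use poisson_central_moments[OF s] in simp_all)
  show "has_bochner_integral (measure_pmf (int_walk directed_step s)) (\<lambda>x. (real_of_int x - s) ^ 4) (3 * s\<^sup>2 + s)"
    by (rule int_walk_has_integral[OF fin _ *[where f = "\<lambda>x. (real_of_int x - s) ^ 4"]])
       (use poisson_central_moments[OF s] in simp_all)
qed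

text \<open>
  Given \<open>n\<close> jumps the characteristic function is \<open>w t ^ n\<close>; the Poisson average of \<open>w ^ n\<close> is
  \<open>exp (s (w - 1))\<close>.
\<close>

lemma int_walk_char:
  assumes s: "s > 0" and fin: "finite (set_pmf \<xi>)"
  defines "w \<equiv> \<lambda>t. measure_pmf.expectation \<xi> (\<lambda>j. cis (t * real_of_int j))"
  shows "measure_pmf.expectation (int_walk \<xi> s) (\<lambda>x. cos (t * real_of_int x + b))
     = Re (cis b * exp (s * (w t - 1)))"
proof -
  have fin': "finite (set_pmf (replicate_pmf n \<xi>))" for n
    by (rule finite_set_replicate_pmf[OF fin])
  have E: "measure_pmf.expectation (replicate_pmf n \<xi>) (\<lambda>js. cos (t * real_of_int (sum_list js) + b))
     = Re (cis b * w t ^ n)" for n b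
  proof (induction n arbitrary: b)
    case (Suc n)
    have rep: "replicate_pmf (Suc n) \<xi> = \<xi> \<bind> (\<lambda>j. map_pmf ((#) j) (replicate_pmf n \<xi>))"
      by (simp add: map_pmf_def)
    have "measure_pmf.expectation (replicate_pmf (Suc n) \<xi>) (\<lambda>js. cos (t * real_of_int (sum_list js) + b))
      = (\<Sum>j\<in>set_pmf \<xi>. pmf \<xi> j * measure_pmf.expectation (replicate_pmf n \<xi>)
          (\<lambda>js. cos (t * real_of_int (sum_list js) + (t * real_of_int j + b))))"
      unfolding rep using fin fin'
      by (subst pmf_expectation_bind[of "set_pmf \<xi>"]) (auto simp: algebra_simps)
    also have "\<dots> = Re (\<Sum>j\<in>set_pmf \<xi>. pmf \<xi> j *\<^sub>R (cis (t * real_of_int j + b) * w t ^ n))"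
      unfolding Suc.IH by simp
    also have "(\<Sum>j\<in>set_pmf \<xi>. pmf \<xi> j *\<^sub>R (cis (t * real_of_int j + b) * w t ^ n))
       = cis b * (\<Sum>j\<in>set_pmf \<xi>. pmf \<xi> j *\<^sub>R cis (t * real_of_int j)) * w t ^ n"
      by (simp add: sum_distrib_left sum_distrib_right cis_mult[symmetric] scaleR_conv_of_real mult_ac)
    also have "(\<Sum>j\<in>set_pmf \<xi>. pmf \<xi> j *\<^sub>R cis (t * real_of_int j)) = w t"
      unfolding w_def using fin by (subst integral_measure_pmf[of "set_pmf \<xi>"]) auto
    finally show ?case by (simp add: mult_ac)
  qed simp
  have "(\<lambda>n. (cis b * exp (- s)) * ((s * w t) ^ n /\<^sub>R fact n)) sums ((cis b * exp (- s)) * exp (s * w t))"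
    by (intro sums_mult exp_converges)
  note pois = sums_Re[OF this]
  have Re_mult: "Re (complex_of_real r * z) = r * Re z" for r z by simp
  from pois
  have "(\<lambda>n. Re ((cis b * exp (- s)) * ((s * w t) ^ n /\<^sub>R fact n))) sums Re ((cis b * exp (- s)) * exp (s * w t))" .
  also have "(\<lambda>n. Re ((cis b * exp (- s)) * ((s * w t) ^ n /\<^sub>R fact n)))
      = (\<lambda>n. pmf (poisson_pmf s) n * Re (cis b * w t ^ n))"
  proof
    fix n
    have "(cis b * exp (- s)) * ((s * w t) ^ n /\<^sub>R fact n)
        = complex_of_real (pmf (poisson_pmf s) n) * (cis b * w t ^ n)"
      using s by (simp add: pmf_poisson power_mult_distrib scaleR_conv_of_real divide_inverse mult_ac
          exp_of_real[symmetric])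
    then show "Re ((cis b * exp (- s)) * ((s * w t) ^ n /\<^sub>R fact n)) = pmf (poisson_pmf s) n * Re (cis b * w t ^ n)"
      by (simp only: Re_mult)
  qed
  also have "(cis b * exp (- s)) * exp (s * w t) = cis b * exp (s * (w t - 1))"
    by (simp add: algebra_simps exp_diff exp_minus exp_of_real[symmetric] divide_inverse)
  finally have sums: "(\<lambda>n. pmf (poisson_pmf s) n * Re (cis b * w t ^ n)) sums Re (cis b * exp (s * (w t - 1)))" .
  have "measure_pmf.expectation (int_walk \<xi> s) (\<lambda>x. cos (t * real_of_int x + b))
    = measure_pmf.expectation (poisson_pmf s) (\<lambda>n. Re (cis b * w t ^ n))"
    unfolding int_walk_def E[symmetric] measure_pmf_bind
    by (subst integral_bind[where K = "count_space UNIV" and B = 1 and B' = 1])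
       (auto simp: measure_pmf_in_subprob_algebra measure_pmf.emeasure_space_1)
  also have "\<dots> = Re (cis b * exp (s * (w t - 1)))"
  proof -
    have "integrable (measure_pmf (poisson_pmf s)) (\<lambda>n. Re (cis b * w t ^ n))"
      unfolding E[symmetric]
      by (rule measure_pmf.integrable_const_bound[where B = 1])
        (auto intro!: AE_pmfI measure_pmf.integral_le_const measure_pmf.integral_ge_const abs_leI
            integrable_measure_pmf_finite fin')
    then have "has_bochner_integral (measure_pmf (poisson_pmf s)) (\<lambda>n. Re (cis b * w t ^ n))
       (measure_pmf.expectation (poisson_pmf s) (\<lambda>n. Re (cis b * w t ^ n)))"
      by (rule has_bochner_integral_integrable)
    with sums show ?thesis
      unfolding has_bochner_integral_pmf_nat_iff using sums_unique2 by blast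
  qed
  finally show ?thesis .
qed

lemma diffusive_simple:
  assumes s: "s > 0"
  shows "diffusive_law (int_walk simple_step s) 0 s (\<lambda>t. complex_of_real (cos t - 1))"
proof unfold_locales
  have fin: "finite (set_pmf simple_step)" by (simp add: simple_step_def)
  have w: "measure_pmf.expectation simple_step (\<lambda>j. cis (t * real_of_int j)) = complex_of_real (cos t)" for t
    unfolding simple_step_def by (subst integral_measure_pmf[of "{1, -1}"]) (auto simp: complex_eq_iff)
  show "measure_pmf.expectation (int_walk simple_step s) (\<lambda>x. cos (t * real_of_int x + b))
      = Re (cis (b + t * 0) * exp (s * complex_of_real (cos t - 1)))" for t b
    unfolding int_walk_char[OF s fin] w by simp
  show "Re (complex_of_real (cos t - 1)) = cos t - 1" for t by simp
  show "cmod (complex_of_real (cos t - 1) + complex_of_real (t\<^sup>2 / 2)) \<le> \<bar>t\<bar> ^ 3" for t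
  proof -
    have app: "cmod (iexp t - (\<Sum>k\<le>2. (\<i> * t)^k / fact k)) \<le> \<bar>t\<bar>^3 / 6"
      using iexp_approx1[of t 2] by (simp add: fact_numeral)
    have Re: "Re (iexp t - (\<Sum>k\<le>2. (\<i> * t)^k / fact k)) = cos t - 1 + t\<^sup>2 / 2"
      by (simp add: numeral_eq_Suc Re_exp power2_eq_square)
    have "complex_of_real (cos t - 1) + complex_of_real (t\<^sup>2 / 2) = complex_of_real (cos t - 1 + t\<^sup>2 / 2)" by simp
    then have "cmod (complex_of_real (cos t - 1) + complex_of_real (t\<^sup>2 / 2)) = \<bar>cos t - 1 + t\<^sup>2 / 2\<bar>"
      by (simp only: norm_of_real)
    also have "\<dots> \<le> \<bar>t\<bar>^3 / 6"
      using order_trans[OF abs_Re_le_cmod app] unfolding Re .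
    finally show ?thesis using zero_le_power[of "\<bar>t\<bar>" 3] by linarith
  qed
  show "has_bochner_integral (measure_pmf (int_walk simple_step s)) (\<lambda>x. (real_of_int x - 0)\<^sup>2) s"
    "has_bochner_integral (measure_pmf (int_walk simple_step s)) (\<lambda>x. (real_of_int x - 0) ^ 4) (3 * s\<^sup>2 + s)"
    using int_walk_moments_simple[OF s] by simp_all
qed (rule s)

lemma diffusive_directed:
  assumes s: "s > 0"
  shows "diffusive_law (int_walk directed_step s) s s (\<lambda>t. cis t - 1 - \<i> * t)"
proof unfold_locales
  have fin: "finite (set_pmf directed_step)" by (simp add: directed_step_def)
  have w: "measure_pmf.expectation directed_step (\<lambda>j. cis (t * real_of_int j)) = cis t" for t
    unfolding directed_step_def by simp
  show "measure_pmf.expectation (int_walk directed_step s) (\<lambda>x. cos (t * real_of_int x + b))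
      = Re (cis (b + t * s) * exp (s * (cis t - 1 - \<i> * t)))" for t b
  proof -
    have "cis (b + t * s) * exp (s * (cis t - 1 - \<i> * t)) = cis b * exp (s * (cis t - 1))"
      by (simp add: cis_conv_exp exp_add[symmetric] algebra_simps)
    then show ?thesis unfolding int_walk_char[OF s fin] w by (simp only:)
  qed
  show "Re (cis t - 1 - \<i> * t) = cos t - 1" for t by simp
  show "cmod (cis t - 1 - \<i> * t + complex_of_real (t\<^sup>2 / 2)) \<le> \<bar>t\<bar> ^ 3" for t
  proof -
    have "cmod (iexp t - (\<Sum>k\<le>2. (\<i> * t)^k / fact k)) \<le> \<bar>t\<bar>^3 / 6"
      using iexp_approx1[of t 2] by (simp add: fact_numeral)
    also have "iexp t - (\<Sum>k\<le>2. (\<i> * t)^k / fact k) = cis t - 1 - \<i> * t + complex_of_real (t\<^sup>2 / 2)"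
      by (simp add: cis_conv_exp numeral_eq_Suc power2_eq_square algebra_simps)
    finally show ?thesis using zero_le_power[of "\<bar>t\<bar>" 3] by linarith
  qed
qed (use s int_walk_moments_directed[OF s] in auto)

section \<open>The entropy asymptotics\<close>

lemma walk_entropy_error:
  assumes \<xi>: "\<xi> = simple_step \<or> \<xi> = directed_step" and s: "s > 0" and L: "L > 0"
  shows "\<bar>walk_entropy \<xi> L s - 1 / 2 * ln (2 * pi * exp 1 * s)\<bar>
     \<le> 436 / ln (1 + s) + 44 * (sqrt (s / (real L)\<^sup>2) + s / (real L)\<^sup>2)"
proof -
  have "walk_entropy \<xi> L s = residue_entropy (int_walk \<xi> s) L"
    by (simp add: walk_entropy_def residue_entropy_def walk_law_eq_map)
  then show ?thesis
    using \<xi> diffusive_law.entropy_error[OF diffusive_simple[OF s] L]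
      diffusive_law.entropy_error[OF diffusive_directed[OF s] L] by auto
qed

theorem propositionB5:
  fixes \<xi> :: "int pmf"
  assumes "\<xi> = simple_step \<or> \<xi> = directed_step"
  shows "(\<exists>f g :: real \<Rightarrow> real.
            (f \<longlongrightarrow> 0) at_top \<and> (g \<longlongrightarrow> 0) (at_right 0) \<and>
            (\<forall>(L::nat) r c. L \<ge> 1 \<longrightarrow> r > 0 \<longrightarrow> c > 0 \<longrightarrow> r \<le> c * (real L)\<^sup>2 \<longrightarrow>
               (\<forall>s\<in>{r..c * (real L)\<^sup>2}.
                  \<bar>walk_entropy \<xi> L s - 1/2 * ln (2 * pi * exp 1 * s)\<bar> \<le> f r + g c)))
       \<and> (\<exists>f g :: real \<Rightarrow> real.
            (f \<longlongrightarrow> 0) at_top \<and> (g \<longlongrightarrow> 0) (at_right 0) \<and>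
            (\<forall>(L::nat) r c. L \<ge> 1 \<longrightarrow> r > 0 \<longrightarrow> c > 0 \<longrightarrow> r \<le> c * (real L)\<^sup>2 \<longrightarrow>
               (\<forall>s\<in>{r..c * (real L)\<^sup>2}.
                  \<bar>walk_rel_entropy \<xi> L s - 1/2 * ln ((real L)\<^sup>2 / s)
                     + 1/2 * ln (2 * pi * exp 1)\<bar> \<le> f r + g c)))"
proof -
  define f :: "real \<Rightarrow> real" where "f = (\<lambda>r. 436 / ln (1 + r))"
  define g :: "real \<Rightarrow> real" where "g = (\<lambda>c. 44 * (sqrt c + c))"
  have f_lim: "(f \<longlongrightarrow> 0) at_top"
    unfolding f_def by real_asymp
  have g_lim: "(g \<longlongrightarrow> 0) (at_right 0)"
    unfolding g_def by real_asymp
  have bound: "\<bar>walk_entropy \<xi> L s - 1/2 * ln (2 * pi * exp 1 * s)\<bar> \<le> f r + g c"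
    if "L \<ge> 1" "r > 0" "s \<in> {r..c * (real L)\<^sup>2}" for L :: nat and r c s
  proof -
    have s: "s > 0" and L: "L > 0" using that by auto
    have "s / (real L)\<^sup>2 \<le> c" using that L by (simp add: divide_le_eq)
    then have "44 * (sqrt (s / (real L)\<^sup>2) + s / (real L)\<^sup>2) \<le> g c"
      unfolding g_def by (intro mult_left_mono add_mono real_sqrt_le_mono) auto
    moreover have "436 / ln (1 + s) \<le> f r"
      unfolding f_def using that by (intro divide_left_mono) auto
    ultimately show ?thesis
      using walk_entropy_error[OF assms s L] by linarith
  qed
  \<comment> \<open>The two errors agree up to sign, so the second claim follows with the same \<open>f\<close> and \<open>g\<close>.\<close>
  have rel: "\<bar>walk_rel_entropy \<xi> L s - 1/2 * ln ((real L)\<^sup>2 / s) + 1/2 * ln (2 * pi * exp 1)\<bar>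
      = \<bar>walk_entropy \<xi> L s - 1/2 * ln (2 * pi * exp 1 * s)\<bar>"
    if "L \<ge> 1" "s > 0" for L :: nat and s
  proof -
    have "ln ((real L)\<^sup>2 / s) = 2 * ln (real L) - ln s"
      using that by (simp add: ln_div ln_realpow)
    moreover have "ln (2 * pi * exp 1 * s) = ln (2 * pi * exp 1) + ln s"
      using that by (intro ln_mult_pos) auto
    ultimately have "walk_rel_entropy \<xi> L s - 1/2 * ln ((real L)\<^sup>2 / s) + 1/2 * ln (2 * pi * exp 1)
        = - (walk_entropy \<xi> L s - 1/2 * ln (2 * pi * exp 1 * s))"
      by (simp add: walk_rel_entropy_def diff_divide_distrib add_divide_distrib)
    then show ?thesis by (simp only: abs_minus_cancel)
  qed
  show ?thesis
  proof (rule conjI; rule exI[of _ f]; rule exI[of _ g]; intro conjI allI impI ballI f_lim g_lim)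
    fix L :: nat and r c s
    assume a: "L \<ge> 1" "r > 0" "s \<in> {r..c * (real L)\<^sup>2}"
    show "\<bar>walk_entropy \<xi> L s - 1/2 * ln (2 * pi * exp 1 * s)\<bar> \<le> f r + g c"
      using bound[OF a] .
    show "\<bar>walk_rel_entropy \<xi> L s - 1/2 * ln ((real L)\<^sup>2 / s) + 1/2 * ln (2 * pi * exp 1)\<bar> \<le> f r + g c"
      using a bound[OF a] by (subst rel) auto
  qed
qed

end
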